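(* Let $\Gamma$ be the cyclic group of order $2$, let $(\tilde G,\tilde p)$ be a $\mathcal{C}_s$-symmetric framework in $\mathbb{R}^2$ (where $\mathcal{C}_s=\{\mathrm{id},\sigma\}$, $\sigma$ the reflection in the $y$-axis) with $\mathcal{C}_s$-gain framework $(G,\psi,p)$. Then: (1) if $(\tilde G,\tilde p)$ is fully-symmetrically isostatic (i.e. $\rho_0$-symmetrically isostatic), then $(G,\psi)$ is $(2,1,3,1)$-gain-tight; (2) if $(\tilde G,\tilde p)$ is anti-symmetrically isostatic (i.e. $\rho_1$-symmetrically isostatic), then $(G,\psi)$ is $(2,1,3,2)$-gain-tight.
   Context: **Frameworks and symmetry.** A framework in $\mathbb{R}^2$ is a pair $(\tilde G,\tilde p)$ with $\tilde G$ a finite simple graph and $\tilde p:V(\tilde G)\to\mathbb{R}^2$ injective; it is assumed that $\tilde p(V(\tilde G))$ affinely spans $\mathbb{R}^2$. $\Gamma=\langle\gamma\rangle$ acts on $\tilde G$ by automorphisms and $\tau:\Gamma\to O(\mathbb{R}^2)$ is the faithful representation with image $\mathcal{C}_s$; $\mathcal{C}_s$-symmetric means $\tau(g)\tilde p(v)=\tilde p(gv)$ for all $g\in\Gamma$, $v\in V(\tilde G)$. A vertex is fixed if it is fixed by all of $\Gamma$, free if its stabiliser is trivial. The rigidity map $R$ sends $m:V(\tilde G)\to\mathbb{C}^2$ to the function $\{u,v\}\mapsto(\tilde p(u)-\tilde p(v))^T(m(u)-m(v))$ on $E(\tilde G)$; $m$ is an infinitesimal motion if $Rm=0$, and trivial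 if $m(u)=M\tilde p(u)+t$ for a fixed skew-symmetric matrix $M$ and vector $t$ (complex entries). **$\rho_j$-symmetrically isostatic.** For $j=0,1$ let $\rho_j(\gamma)=(-1)^j$, $V^j=\{m:V(\tilde G)\to\mathbb{C}^2\mid m(gv)=\overline{\rho_j(g)}\,\tau(g)m(v)\ \forall g,v\}$ and $W^j=\{w:E(\tilde G)\to\mathbb{C}\mid w(ge)=\overline{\rho_j(g)}\,w(e)\ \forall g,e\}$. Then $R$ maps $V^j$ into $W^j$; the block $\tilde R_j(\tilde G,\tilde p)$ of the rigidity matrix is a matrix of $R|_{V^j}:V^j\to W^j$ (rows correspond to a basis of $W^j$). Thus $\tilde R_0$ has one row for each edge orbit of $\tilde G$, while $\tilde R_1$ has one row for each edge orbit with trivial stabiliser (edges fixed by $\gamma$ contribute no row to $\tilde R_1$). A motion is $\rho_j$-symmetric if it lies in $V^j$. $(\tilde G,\tilde p)$ is $\rho_j$-symmetrically isostatic if all its $\rho_j$-symmetric infinitesimal motions are trivial and $\tilde R_j(\tilde G,\tilde p)$ has no non-trivial row dependence. **Quotient gain graph.** $G=\tilde G/\Gamma$ is the multigraph whose vertices and edges are the vertex orbits and edge orbits of $\tilde G$; $V_0(G)$ and $\overline{V(G)}$ are the sets of orbits of fixed and of free vertices (fixed and free vertices of $G$). Choose a representative $v^\star$ of each vertex orbit $v$ and an orientation of each edge of $G$. The gain $\psi(e)\in\Gamma$ of $e=(u,v)$ is: the unique $g$ with $\{u^\star,gv^\star\}\in e$ if $u,v$ are both free; arbitrary if exactly one of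 $u,v$ is fixed; $\mathrm{id}$ if both are fixed. Put $p(v)=\tilde p(v^\star)$; $(G,\psi,p)$ is the gain framework. **Sparsity.** For a subgraph $H$ of $G$, $V_0(H)=V(H)\cap V_0(G)$, $\overline{V(H)}=V(H)\cap\overline{V(G)}$. The gain of a walk is the product of $\psi(e)^{\pm1}$ along it (sign according to orientation). $H$ is balanced if, after deleting all fixed vertices and their incident edges, every cycle (including loops and 2-cycles of parallel edges) has gain $\mathrm{id}$. $(G,\psi)$ is $(2,m,3,l)$-gain-sparse if $|E(H)|\le2|V(H)|-3$ for every balanced subgraph $H$ with $E(H)\ne\emptyset$ and $|E(H)|\le2|\overline{V(H)}|+m|V_0(H)|-l$ for every subgraph $H$ with $E(H)\ne\emptyset$; it is $(2,m,3,l)$-gain-tight if moreover $|E(G)|=2|\overline{V(G)}|+m|V_0(G)|-l$.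
   Formalization: Part (2) additionally assumes that no edge of the covering graph is fixed by the reflection; without this it fails, e.g. for the triangle (0,1), (1,0), (-1,0) with all three edges, which is anti-symmetrically isostatic but not (2,1,3,2)-gain-tight. *)

theory Defs
  imports "HOL-Analysis.Analysis" "HOL-Algebra.Group_Action" "HOL-Library.Function_Algebras"
begin

section \<open>Complex vector spaces of functions\<close>

definition motion_scale :: "complex \<Rightarrow> ('a \<Rightarrow> complex^2) \<Rightarrow> 'a \<Rightarrow> complex^2" where
  "motion_scale c m = (\<lambda>v. c *s m v)"

definition edge_scale :: "complex \<Rightarrow> ('b \<Rightarrow> complex) \<Rightarrow> 'b \<Rightarrow> complex" where
  "edge_scale c w = (\<lambda>e. c * w e)"

global_interpretation motion: vector_space motion_scale
  by unfold_locales
    (auto simp: motion_scale_def fun_eq_iff vec_eq_iff algebra_simps)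

global_interpretation edge: vector_space edge_scale
  by unfold_locales (auto simp: edge_scale_def fun_eq_iff algebra_simps)

definition complex_vec :: "real^2 \<Rightarrow> complex^2" where
  "complex_vec x = (\<chi> i. complex_of_real (x $ i))"

definition complex_mat :: "real^2^2 \<Rightarrow> complex^2^2" where
  "complex_mat A = (\<chi> i k. complex_of_real (A $ i $ k))"

section \<open>Frameworks with reflection symmetry\<close>

definition reflection_y_axis :: "real^2^2" where
  "reflection_y_axis = vector [vector [-1, 0], vector [0, 1]]"

locale cs_framework = group_action \<Gamma> V \<phi>
  for \<Gamma> :: "('g, 'z) monoid_scheme" (structure)
    and V :: "'a set" and \<phi> :: "'g \<Rightarrow> 'a \<Rightarrow> 'a" +
  fixes E :: "'a set set"
    and \<tau> :: "'g \<Rightarrow> real^2^2"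
    and p :: "'a \<Rightarrow> real^2"
  assumes order_two: "order \<Gamma> = 2"
    and finite_verts: "finite V"
    and simple: "\<And>e. e \<in> E \<Longrightarrow> e \<subseteq> V \<and> card e = 2"
    and automorphism: "\<And>g e. g \<in> carrier \<Gamma> \<Longrightarrow> e \<in> E \<Longrightarrow> \<phi> g ` e \<in> E"
    and rep_mult: "\<And>g h. g \<in> carrier \<Gamma> \<Longrightarrow> h \<in> carrier \<Gamma> \<Longrightarrow> \<tau> (g \<otimes> h) = \<tau> g ** \<tau> h"
    and rep_faithful: "inj_on \<tau> (carrier \<Gamma>)"
    and rep_image: "\<tau> ` carrier \<Gamma> = {mat 1, reflection_y_axis}"
    and placement_inj: "inj_on p V"
    and placement_spans: "affine hull (p ` V) = UNIV"
    and placement_sym: "\<And>g v. g \<in> carrier \<Gamma> \<Longrightarrow> v \<in> V \<Longrightarrow> \<tau> g *v p v = p (\<phi> g v)"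
begin

definition edge_action :: "'g \<Rightarrow> 'a set \<Rightarrow> 'a set" where
  "edge_action g e = \<phi> g ` e"

definition fixed :: "'a \<Rightarrow> bool" where
  "fixed v \<longleftrightarrow> stabilizer \<Gamma> \<phi> v = carrier \<Gamma>"

definition irrep :: "nat \<Rightarrow> 'g \<Rightarrow> complex" where
  "irrep j g = (if g = \<one> then 1 else (-1) ^ j)"

text \<open>Functions on \<open>V\<close> and on \<open>E\<close> are represented by functions on the whole type which vanish
  outside \<open>V\<close>, respectively \<open>E\<close>.\<close>

definition sym_motion_space :: "nat \<Rightarrow> ('a \<Rightarrow> complex^2) set" where
  "sym_motion_space j = {m. (\<forall>v. v \<notin> V \<longrightarrow> m v = 0) \<and>
     (\<forall>g\<in>carrier \<Gamma>. \<forall>v\<in>V. m (\<phi> g v) = cnj (irrep j g) *s (complex_mat (\<tau> g) *v m v))}"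

definition sym_edge_space :: "nat \<Rightarrow> ('a set \<Rightarrow> complex) set" where
  "sym_edge_space j = {w. (\<forall>e. e \<notin> E \<longrightarrow> w e = 0) \<and>
     (\<forall>g\<in>carrier \<Gamma>. \<forall>e\<in>E. w (edge_action g e) = cnj (irrep j g) * w e)}"

text \<open>The value on an edge is unchanged when its two ends are exchanged, so the description
  below determines it.\<close>

definition rigidity_map :: "('a \<Rightarrow> complex^2) \<Rightarrow> 'a set \<Rightarrow> complex" where
  "rigidity_map m e = (if e \<in> E
     then THE x. \<exists>u v. e = {u, v} \<and>
       x = (\<Sum>i\<in>UNIV. complex_vec (p u - p v) $ i * (m u - m v) $ i)
     else 0)"

definition infinitesimal_motion :: "('a \<Rightarrow> complex^2) \<Rightarrow> bool" where
  "infinitesimal_motion m \<longleftrightarrow> (\<forall>e\<in>E. rigidity_map m e = 0)"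

definition trivial_motion :: "('a \<Rightarrow> complex^2) \<Rightarrow> bool" where
  "trivial_motion m \<longleftrightarrow> (\<exists>(M :: complex^2^2) t. transpose M = - M \<and>
     (\<forall>u\<in>V. m u = M *v complex_vec (p u) + t))"

text \<open>\<open>A\<close> is the matrix of the rigidity map from \<open>sym_motion_space j\<close> to \<open>sym_edge_space j\<close>
  with respect to the bases \<open>C\<close> and \<open>B\<close>; its rows are indexed by \<open>B\<close> and its columns by \<open>C\<close>.\<close>

definition is_rigidity_block ::
    "nat \<Rightarrow> ('a set \<Rightarrow> complex) set \<Rightarrow> ('a \<Rightarrow> complex^2) set \<Rightarrow>
     (('a set \<Rightarrow> complex) \<Rightarrow> ('a \<Rightarrow> complex^2) \<Rightarrow> complex) \<Rightarrow> bool" where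
  "is_rigidity_block j B C A \<longleftrightarrow>
     finite B \<and> edge.independent B \<and> edge.span B = sym_edge_space j \<and>
     finite C \<and> motion.independent C \<and> motion.span C = sym_motion_space j \<and>
     (\<forall>c\<in>C. rigidity_map c = (\<Sum>b\<in>B. edge_scale (A b c) b))"

text \<open>A change of bases multiplies the block by invertible matrices on both sides, so the
  bases chosen do not affect whether its rows are independent.\<close>

definition symmetrically_isostatic :: "nat \<Rightarrow> bool" where
  "symmetrically_isostatic j \<longleftrightarrow>
     (\<forall>m\<in>sym_motion_space j. infinitesimal_motion m \<longrightarrow> trivial_motion m) \<and>
     (\<exists>B C A. is_rigidity_block j B C A \<and>
        (\<forall>r. (\<forall>c\<in>C. (\<Sum>b\<in>B. r b * A b c) = 0) \<longrightarrow> (\<forall>b\<in>B. r b = 0)))"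

text \<open>Elements of \<open>sym_edge_space 1\<close> vanish on edges with nontrivial stabiliser, so such edges
  give no row of the block for \<open>j = 1\<close>: adding them preserves being symmetrically isostatic for
  \<open>j = 1\<close>, although it adds edges to the quotient graph. For instance, a triangle with vertices
  \<open>(0,1)\<close>, \<open>(1,0)\<close>, \<open>(-1,0)\<close> is symmetrically isostatic for \<open>j = 1\<close> with or without its
  horizontal edge. Counts for \<open>j = 1\<close> therefore need the following condition.\<close>

definition edges_free :: bool where
  "edges_free \<longleftrightarrow> (\<forall>e\<in>E. stabilizer \<Gamma> edge_action e = {\<one>})"

end

section \<open>Gain graphs\<close>

text \<open>An oriented multigraph with a distinguished set of fixed vertices. The orientation only
  serves to read off gains.\<close>

record ('v, 'e) multigraph =
  verts :: "'v set"
  fixed_verts :: "'v set"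
  edges :: "'e set"
  src :: "'e \<Rightarrow> 'v"
  tgt :: "'e \<Rightarrow> 'v"

definition is_subgraph :: "'v set \<Rightarrow> 'e set \<Rightarrow> ('v, 'e) multigraph \<Rightarrow> bool" where
  "is_subgraph VH EH G \<longleftrightarrow> VH \<subseteq> verts G \<and> EH \<subseteq> edges G \<and>
     (\<forall>e\<in>EH. src G e \<in> VH \<and> tgt G e \<in> VH)"

text \<open>A step \<open>(e, b)\<close> of a walk runs along \<open>e\<close>, with the orientation if \<open>b\<close> and against it
  otherwise.\<close>

definition step_start :: "('v, 'e) multigraph \<Rightarrow> 'e \<times> bool \<Rightarrow> 'v" where
  "step_start G s = (if snd s then src G (fst s) else tgt G (fst s))"

definition step_end :: "('v, 'e) multigraph \<Rightarrow> 'e \<times> bool \<Rightarrow> 'v" where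
  "step_end G s = (if snd s then tgt G (fst s) else src G (fst s))"

definition walk_gain :: "('g, 'z) monoid_scheme \<Rightarrow> ('e \<Rightarrow> 'g) \<Rightarrow> ('e \<times> bool) list \<Rightarrow> 'g" where
  "walk_gain \<Gamma> \<psi> ss =
     foldr (\<lambda>s x. (if snd s then \<psi> (fst s) else inv\<^bsub>\<Gamma>\<^esub> \<psi> (fst s)) \<otimes>\<^bsub>\<Gamma>\<^esub> x) ss \<one>\<^bsub>\<Gamma>\<^esub>"

text \<open>Distinctness of both edges and vertices admits loops (length one) and pairs of parallel
  edges (length two), but not going back and forth along one edge.\<close>

definition is_cycle :: "('v, 'e) multigraph \<Rightarrow> 'e set \<Rightarrow> ('e \<times> bool) list \<Rightarrow> bool" where
  "is_cycle G F ss \<longleftrightarrow> ss \<noteq> [] \<and> fst ` set ss \<subseteq> F \<and>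
     (\<forall>i. Suc i < length ss \<longrightarrow> step_end G (ss ! i) = step_start G (ss ! Suc i)) \<and>
     step_end G (last ss) = step_start G (hd ss) \<and>
     distinct (map fst ss) \<and> distinct (map (step_start G) ss)"

definition balanced ::
    "('g, 'z) monoid_scheme \<Rightarrow> ('v, 'e) multigraph \<Rightarrow> ('e \<Rightarrow> 'g) \<Rightarrow> 'e set \<Rightarrow> bool" where
  "balanced \<Gamma> G \<psi> EH \<longleftrightarrow>
     (\<forall>ss. is_cycle G {e \<in> EH. src G e \<notin> fixed_verts G \<and> tgt G e \<notin> fixed_verts G} ss
       \<longrightarrow> walk_gain \<Gamma> \<psi> ss = \<one>\<^bsub>\<Gamma>\<^esub>)"

text \<open>The counts are integers, since the right-hand sides may be negative.\<close>

definition gain_sparse ::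
    "('g, 'z) monoid_scheme \<Rightarrow> ('v, 'e) multigraph \<Rightarrow> ('e \<Rightarrow> 'g) \<Rightarrow>
     int \<Rightarrow> int \<Rightarrow> int \<Rightarrow> int \<Rightarrow> bool" where
  "gain_sparse \<Gamma> G \<psi> k m h l \<longleftrightarrow>
     (\<forall>VH EH. is_subgraph VH EH G \<and> EH \<noteq> {} \<longrightarrow>
        (balanced \<Gamma> G \<psi> EH \<longrightarrow> int (card EH) \<le> k * int (card VH) - h) \<and>
        int (card EH) \<le>
          k * int (card (VH - fixed_verts G)) + m * int (card (VH \<inter> fixed_verts G)) - l)"

definition gain_tight ::
    "('g, 'z) monoid_scheme \<Rightarrow> ('v, 'e) multigraph \<Rightarrow> ('e \<Rightarrow> 'g) \<Rightarrow>
     int \<Rightarrow> int \<Rightarrow> int \<Rightarrow> int \<Rightarrow> bool" where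
  "gain_tight \<Gamma> G \<psi> k m h l \<longleftrightarrow> gain_sparse \<Gamma> G \<psi> k m h l \<and>
     int (card (edges G)) =
       k * int (card (verts G - fixed_verts G)) + m * int (card (verts G \<inter> fixed_verts G)) - l"

section \<open>The gain framework of a symmetric framework\<close>

text \<open>\<open>rep\<close> chooses a representative of every vertex orbit, and \<open>q\<close> is the placement of the
  quotient. As \<open>\<Gamma>\<close> has order two, the vertex orbits that are not fixed are the free ones.\<close>

locale cs_gain_framework = cs_framework \<Gamma> V \<phi> E \<tau> p
  for \<Gamma> :: "('g, 'z) monoid_scheme" (structure)
    and V :: "'a set" and \<phi> :: "'g \<Rightarrow> 'a \<Rightarrow> 'a"
    and E :: "'a set set" and \<tau> :: "'g \<Rightarrow> real^2^2" and p :: "'a \<Rightarrow> real^2" +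
  fixes rep :: "'a set \<Rightarrow> 'a"
    and G :: "('a set, 'a set set) multigraph"
    and \<psi> :: "'a set set \<Rightarrow> 'g"
    and q :: "'a set \<Rightarrow> real^2"
  assumes verts_eq: "verts G = orbits \<Gamma> V \<phi>"
    and fixed_verts_eq: "fixed_verts G = orbits \<Gamma> {v \<in> V. fixed v} \<phi>"
    and edges_eq: "edges G = orbits \<Gamma> E edge_action"
    and rep_mem: "\<And>x. x \<in> verts G \<Longrightarrow> rep x \<in> x"
    and ends: "\<And>e. e \<in> edges G \<Longrightarrow>
      \<exists>u v. {u, v} \<in> e \<and> src G e = orbit \<Gamma> \<phi> u \<and> tgt G e = orbit \<Gamma> \<phi> v"
    and gain_closed: "\<And>e. e \<in> edges G \<Longrightarrow> \<psi> e \<in> carrier \<Gamma>"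
    and gain_free: "\<And>e. e \<in> edges G \<Longrightarrow> src G e \<notin> fixed_verts G \<Longrightarrow> tgt G e \<notin> fixed_verts G \<Longrightarrow>
      {rep (src G e), \<phi> (\<psi> e) (rep (tgt G e))} \<in> e"
    and gain_fixed: "\<And>e. e \<in> edges G \<Longrightarrow> src G e \<in> fixed_verts G \<Longrightarrow> tgt G e \<in> fixed_verts G \<Longrightarrow>
      \<psi> e = \<one>"
    and quotient_placement: "\<And>x. x \<in> verts G \<Longrightarrow> q x = p (rep x)"

end

theory Submission
  imports Defs
begin

text \<open>Independent rows make the rigidity map from \<open>sym_motion_space j\<close> onto \<open>sym_edge_space j\<close>
  surjective. A symmetric motion is determined by two coordinates for each free and one for each
  fixed vertex orbit. On a subgraph with an edge, the restricted map still attains all values on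
  the edges, and the symmetric rigid motions (vertical translations for \<open>j = 0\<close>; horizontal
  translations and rotations for \<open>j = 1\<close>) attain all values of one or two coordinates without
  changing the values on the edges. So the number of edges plus that number is at most the number
  of coordinates, with equality on the whole graph because all symmetric infinitesimal motions
  are trivial. On a balanced subgraph, vertex representatives can be chosen with all gains between
  free vertices trivial; the edges are then those of a plane framework without symmetry on the
  representatives, and the three-dimensional space of all rigid motions gives the count.\<close>

section \<open>Dimension counts\<close>

text \<open>Functions live on a whole type, so the coordinate space of \<open>I\<close> is realised
  as the functions supported in \<open>I\<close>, with the unit functions as its standard
  basis.\<close>

lemma span_unit_functions:
  assumes "finite I"
  shows "edge.span ((\<lambda>i k. if k = i then 1 else 0) ` I) = {z. \<forall>i. i \<notin> I \<longrightarrow> z i = 0}"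
    (is "edge.span (?\<delta> ` I) = ?S")
proof
  show "edge.span (?\<delta> ` I) \<subseteq> ?S"
    by (rule edge.span_minimal)
      (auto simp: edge.subspace_def edge_scale_def)
  show "?S \<subseteq> edge.span (?\<delta> ` I)"
  proof
    fix z assume z: "z \<in> ?S"
    have "z = (\<Sum>i\<in>I. edge_scale (z i) (?\<delta> i))"
    proof
      fix k
      have "(\<Sum>i\<in>I. edge_scale (z i) (?\<delta> i)) k = (\<Sum>i\<in>I. if k = i then z i else 0)"
        by (induction I rule: infinite_finite_induct) (auto simp: edge_scale_def)
      also have "\<dots> = z k"
        using z assms by simp
      finally show "z k = (\<Sum>i\<in>I. edge_scale (z i) (?\<delta> i)) k" ..
    qed
    also have "\<dots> \<in> edge.span (?\<delta> ` I)"
      by (intro edge.span_sum edge.span_scale edge.span_base) auto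
    finally show "z \<in> edge.span (?\<delta> ` I)" .
  qed
qed

lemma inj_unit_functions: "inj_on (\<lambda>i k. if k = i then 1 else 0 :: complex) I"
  by (auto simp: inj_on_def fun_eq_iff split: if_splits)

lemma independent_unit_functions:
  "edge.independent ((\<lambda>i k. if k = i then 1 else 0) ` I)" (is "edge.independent (?\<delta> ` I)")
proof
  assume "edge.dependent (?\<delta> ` I)"
  then obtain T c where T: "finite T" "T \<subseteq> ?\<delta> ` I" "(\<Sum>v\<in>T. edge_scale (c v) v) = 0"
    and "\<exists>v\<in>T. c v \<noteq> 0"
    by (auto simp: edge.dependent_explicit)
  then obtain i where i: "?\<delta> i \<in> T" "c (?\<delta> i) \<noteq> 0" by blast
  have "0 = (\<Sum>v\<in>T. edge_scale (c v) v) i" by (simp add: T)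
  also have "\<dots> = (\<Sum>v\<in>T. c v * v i)"
    by (induction T rule: infinite_finite_induct) (auto simp: edge_scale_def)
  \<comment> \<open>Evaluation at \<open>i\<close> annihilates every other unit function, which
    isolates one coefficient.\<close>
  also have "\<dots> = (\<Sum>v\<in>T. if v = ?\<delta> i then c (?\<delta> i) else 0)"
  proof (intro sum.cong refl)
    fix v assume "v \<in> T"
    then obtain k where "v = ?\<delta> k" using T(2) by blast
    then show "c v * v i = (if v = ?\<delta> i then c (?\<delta> i) else 0)"
      by (cases "k = i") (auto dest: fun_cong[of _ _ i])
  qed
  also have "\<dots> = c (?\<delta> i)" using i T(1) by simp
  finally show False using i by simp
qed

lemma linear_restrict:
  assumes "Vector_Spaces.linear edge_scale edge_scale F"
  shows "Vector_Spaces.linear edge_scale edge_scale (\<lambda>z x. if x \<in> X then F z x else 0)"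
proof -
  interpret F: Vector_Spaces.linear edge_scale edge_scale F by fact
  show ?thesis
    using F.add F.scale by unfold_locales (auto simp: edge_scale_def fun_eq_iff)
qed

text \<open>The unit functions on \<open>X\<close> are independent and lie in the span of the images
  of the unit functions on \<open>I\<close>.\<close>

lemma card_le_of_linear_surj:
  assumes F: "Vector_Spaces.linear edge_scale edge_scale F" and fin: "finite I" "finite X"
    and surj: "\<And>w. \<exists>z. (\<forall>i. i \<notin> I \<longrightarrow> z i = 0) \<and> (\<forall>x\<in>X. F z x = w x)"
  shows "card X \<le> card I"
proof -
  let ?\<delta> = "\<lambda>i k. if k = i then 1 else 0 :: complex"
  \<comment> \<open>Truncation to \<open>X\<close> turns agreement on \<open>X\<close> into equality
    of functions.\<close>
  define F' where "F' = (\<lambda>z x. if x \<in> X then F z x else 0)"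
  interpret F': Vector_Spaces.linear edge_scale edge_scale F'
    unfolding F'_def by (rule linear_restrict[OF F])
  have "?\<delta> ` X \<subseteq> F' ` edge.span (?\<delta> ` I)"
  proof
    fix w assume w: "w \<in> ?\<delta> ` X"
    obtain z where "\<forall>i. i \<notin> I \<longrightarrow> z i = 0" "\<forall>x\<in>X. F z x = w x" using surj by blast
    then have "F' z = w" using w by (auto simp: F'_def fun_eq_iff)
    then show "w \<in> F' ` edge.span (?\<delta> ` I)"
      using \<open>\<forall>i. i \<notin> I \<longrightarrow> z i = 0\<close> by (auto simp: span_unit_functions[OF fin(1)])
  qed
  also have "\<dots> = edge.span (F' ` ?\<delta> ` I)" by (simp add: F'.span_image)
  finally have sub: "?\<delta> ` X \<subseteq> edge.span (F' ` ?\<delta> ` I)" .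
  have "card (?\<delta> ` X) \<le> card (F' ` ?\<delta> ` I)"
    using edge.independent_span_bound[OF _ independent_unit_functions sub] fin by simp
  also have "\<dots> \<le> card I"
    using fin by (metis card_image_le finite_imageI image_image)
  finally show ?thesis by (simp add: card_image[OF inj_unit_functions])
qed

text \<open>Dual to the surjective case: a trivial kernel keeps the images of the unit functions on
  \<open>I\<close> independent, inside a space spanned by \<open>card X\<close> functions.\<close>

lemma card_le_of_linear_inj:
  assumes F: "Vector_Spaces.linear edge_scale edge_scale F" and fin: "finite I" "finite X"
    and ker: "\<And>z. \<forall>i. i \<notin> I \<longrightarrow> z i = 0 \<Longrightarrow> \<forall>x\<in>X. F z x = 0 \<Longrightarrow> z = 0"
  shows "card I \<le> card X"
proof -
  let ?\<delta> = "\<lambda>i k. if k = i then 1 else 0 :: complex"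
  define F' where "F' = (\<lambda>z x. if x \<in> X then F z x else 0)"
  interpret F': Vector_Spaces.linear edge_scale edge_scale F'
    unfolding F'_def by (rule linear_restrict[OF F])
  have inj: "inj_on F' (edge.span (?\<delta> ` I))"
    unfolding F'.inj_on_iff_eq_0[OF edge.subspace_span]
  proof safe
    fix z assume "z \<in> edge.span (?\<delta> ` I)" and F'z: "F' z = 0"
    then have "\<forall>i. i \<notin> I \<longrightarrow> z i = 0" by (simp add: span_unit_functions[OF fin(1)])
    have "F z x = 0" if "x \<in> X" for x
      using fun_cong[OF F'z, of x] that by (simp add: F'_def)
    with \<open>\<forall>i. i \<notin> I \<longrightarrow> z i = 0\<close> show "z = 0" using ker by blast
  qed
  have "edge.independent (F' ` ?\<delta> ` I)"
    by (rule F'.independent_injective_image[OF independent_unit_functions inj])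
  moreover have "F' ` ?\<delta> ` I \<subseteq> edge.span (?\<delta> ` X)"
    by (auto simp: span_unit_functions[OF fin(2)] F'_def)
  ultimately have "card (F' ` ?\<delta> ` I) \<le> card (?\<delta> ` X)"
    using edge.independent_span_bound fin by blast
  moreover have "card (F' ` ?\<delta> ` I) = card I"
    using inj_on_subset[OF inj edge.span_superset]
    by (simp add: card_image inj_unit_functions)
  ultimately show ?thesis by (simp add: card_image[OF inj_unit_functions])
qed

section \<open>Potentials of balanced gain graphs\<close>

primrec walk :: "('v, 'e) multigraph \<Rightarrow> 'e set \<Rightarrow> 'v \<Rightarrow> ('e \<times> bool) list \<Rightarrow> 'v \<Rightarrow> bool" where
  "walk G F u [] w \<longleftrightarrow> u = w"
| "walk G F u (s # ss) w \<longleftrightarrow> fst s \<in> F \<and> step_start G s = u \<and> walk G F (step_end G s) ss w"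

lemma walk_append: "walk G F u (xs @ ys) w \<longleftrightarrow> (\<exists>x. walk G F u xs x \<and> walk G F x ys w)"
  by (induction xs arbitrary: u) auto

text \<open>The tail is made simple first. A new first vertex that recurs in the tail closes a
  detour, which is dropped.\<close>

lemma walk_imp_simple_walk:
  assumes "walk G F u ss w"
  shows "\<exists>ss. walk G F u ss w \<and> distinct (map (step_start G) ss) \<and> w \<notin> step_start G ` set ss"
  using assms
proof (induction ss arbitrary: u)
  case Nil
  then show ?case by (intro exI[of _ "[]"]) auto
next
  case (Cons s ss)
  then obtain ts where ts: "walk G F (step_end G s) ts w" "distinct (map (step_start G) ts)"
      "w \<notin> step_start G ` set ts"
    by auto
  show ?case
  proof (cases "u \<in> step_start G ` set ts")
    case True
    \<comment> \<open>\<open>xs\<close> leads back to \<open>u\<close>; what remains from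
      \<open>s'\<close> on is a part of a simple walk.\<close>
    then obtain xs s' ys where split: "ts = xs @ s' # ys" "step_start G s' = u"
      by (metis imageE split_list)
    with ts show ?thesis by (intro exI[of _ "s' # ys"]) (auto simp: walk_append)
  next
    case False
    show ?thesis
    proof (cases "u = w")
      case True
      then show ?thesis by (intro exI[of _ "[]"]) auto
    next
      case neq: False
      with False ts Cons.prems show ?thesis by (intro exI[of _ "s # ts"]) auto
    qed
  qed
qed

lemma walk_mono: "walk G F u ss w \<Longrightarrow> F \<subseteq> F' \<Longrightarrow> walk G F' u ss w"
  by (induction ss arbitrary: u) auto

lemma walk_fst: "walk G F u ss w \<Longrightarrow> fst ` set ss \<subseteq> F"
  by (induction ss arbitrary: u) auto

lemma walk_step_end:
  "walk G F u ss w \<Longrightarrow> s \<in> set ss \<Longrightarrow> step_end G s \<in> insert w (step_start G ` set ss)"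
proof (induction ss arbitrary: u)
  case (Cons t ss)
  then show ?case by (cases ss) auto
qed simp

lemma walk_hd: "walk G F u (s # ss) w \<Longrightarrow> step_start G s = u"
  by simp

lemma walk_last: "walk G F u ss w \<Longrightarrow> ss \<noteq> [] \<Longrightarrow> step_end G (last ss) = w"
  by (induction ss arbitrary: u) auto

lemma walk_nth:
  "walk G F u ss w \<Longrightarrow> Suc i < length ss \<Longrightarrow> step_end G (ss ! i) = step_start G (ss ! Suc i)"
proof (induction ss arbitrary: u i)
  case (Cons s ss)
  then show ?case by (cases i; cases ss) auto
qed simp

text \<open>If a later step used the same edge, in either direction, the start of the first step
  would be the start or the end of that later step, hence a later start or \<open>w\<close>.\<close>

lemma simple_walk_distinct_edges:
  "walk G F u ss w \<Longrightarrow> distinct (map (step_start G) ss) \<Longrightarrow> w \<notin> step_start G ` set ss \<Longrightarrow>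
    distinct (map fst ss)"
proof (induction ss arbitrary: u)
  case (Cons s ss)
  have "fst t \<noteq> fst s" if t: "t \<in> set ss" for t
  proof
    assume "fst t = fst s"
    then have "step_start G s = step_start G t \<or> step_start G s = step_end G t"
      by (cases s; cases t) (auto simp: step_start_def step_end_def)
    then show False
      using walk_step_end[of G F "step_end G s" ss w t] Cons.prems t by auto
  qed
  then show ?case using Cons by force
qed simp

section \<open>Gains along walks and potentials\<close>

context group
begin

lemma walk_gain_closed:
  "fst ` set ss \<subseteq> F \<Longrightarrow> (\<And>e. e \<in> F \<Longrightarrow> \<psi> e \<in> carrier G) \<Longrightarrow> walk_gain G \<psi> ss \<in> carrier G"
  by (induction ss) (auto simp: walk_gain_def)

text \<open>The gains telescope: a forward step multiplies the potential by the gain, a backward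
  step by its inverse.\<close>

lemma walk_gain_potential:
  assumes closed: "\<And>e. e \<in> F \<Longrightarrow> \<psi> e \<in> carrier G" and \<theta>: "\<And>x. \<theta> x \<in> carrier G"
    and pot: "\<And>e. e \<in> F \<Longrightarrow> \<theta> (src M e) \<otimes> \<psi> e = \<theta> (tgt M e)"
  shows "walk M F u ss w \<Longrightarrow> \<theta> u \<otimes> walk_gain G \<psi> ss = \<theta> w"
proof (induction ss arbitrary: u)
  case Nil
  then show ?case using \<theta> by (simp add: walk_gain_def)
next
  case (Cons s ss)
  obtain e b where s: "s = (e, b)" by fastforce
  from Cons.prems s have e: "e \<in> F" by simp
  let ?g = "if b then \<psi> e else inv \<psi> e"
  have "\<theta> (tgt M e) \<otimes> inv \<psi> e = \<theta> (src M e)"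
    using pot[OF e] \<theta> closed[OF e] by (metis inv_solve_right)
  then have step: "\<theta> u \<otimes> ?g = \<theta> (step_end M s)"
    using Cons.prems s pot[OF e] by (auto simp: step_start_def step_end_def)
  have "walk_gain G \<psi> ss \<in> carrier G"
    using Cons.prems walk_fst walk_gain_closed closed by (metis walk.simps(2))
  moreover have "walk_gain G \<psi> (s # ss) = ?g \<otimes> walk_gain G \<psi> ss"
    by (simp add: walk_gain_def s)
  ultimately have "\<theta> u \<otimes> walk_gain G \<psi> (s # ss) = \<theta> (step_end M s) \<otimes> walk_gain G \<psi> ss"
    using step \<theta> closed[OF e] by (simp add: m_assoc[symmetric])
  then show ?case using Cons by simp
qed

text \<open>Edges are added one at a time. An edge joining two components is made consistent by
  translating the potential on one of them; an edge inside a component closes a cycle.\<close>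

lemma balanced_potential:
  assumes "finite F" and "\<And>e. e \<in> F \<Longrightarrow> \<psi> e \<in> carrier G"
    and "\<And>ss. is_cycle M F ss \<Longrightarrow> walk_gain G \<psi> ss = \<one>"
  shows "\<exists>\<theta>. (\<forall>x. \<theta> x \<in> carrier G) \<and> (\<forall>e\<in>F. \<theta> (src M e) \<otimes> \<psi> e = \<theta> (tgt M e))"
  using assms
proof (induction F)
  case empty
  then show ?case by (intro exI[of _ "\<lambda>_. \<one>"]) auto
next
  case (insert e F)
  have "\<exists>\<theta>. (\<forall>x. \<theta> x \<in> carrier G) \<and> (\<forall>e\<in>F. \<theta> (src M e) \<otimes> \<psi> e = \<theta> (tgt M e))"
  proof (rule insert.IH)
    show "\<psi> e \<in> carrier G" if "e \<in> F" for e using that insert.prems(1) by simp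
    show "walk_gain G \<psi> ss = \<one>" if "is_cycle M F ss" for ss
      using that insert.prems(2)[of ss] by (auto simp: is_cycle_def)
  qed
  then obtain \<theta> where \<theta>: "\<And>x. \<theta> x \<in> carrier G"
    and pot: "\<And>e. e \<in> F \<Longrightarrow> \<theta> (src M e) \<otimes> \<psi> e = \<theta> (tgt M e)"
    by blast
  have \<psi>: "\<psi> e \<in> carrier G" "\<And>f. f \<in> F \<Longrightarrow> \<psi> f \<in> carrier G" using insert.prems(1) by auto
  define u v where "u = src M e" and "v = tgt M e"
  show ?case
  proof (cases "\<exists>ss. walk M F v ss u")
    case True
    then obtain ss' where "walk M F v ss' u" ..
    from walk_imp_simple_walk[OF this] obtain ss where
      ss: "walk M F v ss u" "distinct (map (step_start M) ss)" "u \<notin> step_start M ` set ss"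
      by auto
    let ?c = "(e, True) # ss"
    have w: "walk M (insert e F) u ?c u"
      using walk_mono[OF ss(1), of "insert e F"]
      by (auto simp: step_start_def step_end_def u_def v_def)
    have "is_cycle M (insert e F) ?c"
      unfolding is_cycle_def
    proof (intro conjI)
      show "fst ` set ?c \<subseteq> insert e F" using walk_fst[OF w] .
      show "\<forall>i. Suc i < length ?c \<longrightarrow> step_end M (?c ! i) = step_start M (?c ! Suc i)"
        using walk_nth[OF w] by blast
      show "step_end M (last ?c) = step_start M (hd ?c)"
        using walk_last[OF w] walk_hd[OF w] by simp
      show "distinct (map fst ?c)"
        using simple_walk_distinct_edges[OF ss] walk_fst[OF ss(1)] insert.hyps by auto
      show "distinct (map (step_start M) ?c)"
        using ss by (simp add: step_start_def u_def)
    qed simp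
    then have "walk_gain G \<psi> ?c = \<one>" by (rule insert.prems(2))
    then have g: "\<psi> e \<otimes> walk_gain G \<psi> ss = \<one>" by (simp add: walk_gain_def)
    have gc: "walk_gain G \<psi> ss \<in> carrier G"
      by (rule walk_gain_closed[OF walk_fst[OF ss(1)] \<psi>(2)])
    \<comment> \<open>The old potential already accounts for the way back from \<open>v\<close> to
      \<open>u\<close>; cancelling its gain leaves the equation for \<open>e\<close>.\<close>
    have "\<theta> v \<otimes> walk_gain G \<psi> ss = \<theta> u"
      by (rule walk_gain_potential[OF \<psi>(2) \<theta> pot ss(1)])
    also have "\<dots> = \<theta> u \<otimes> (\<psi> e \<otimes> walk_gain G \<psi> ss)" using g \<theta> by simp
    also have "\<dots> = \<theta> u \<otimes> \<psi> e \<otimes> walk_gain G \<psi> ss" using \<theta> \<psi> gc by (simp add: m_assoc)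
    finally have "\<theta> u \<otimes> \<psi> e = \<theta> v" using \<theta> \<psi> gc by simp
    then show ?thesis using \<theta> pot by (auto simp: u_def v_def)
  next
    case False
    \<comment> \<open>The component of \<open>v\<close> with respect to the old edges. No old edge
      leaves it, so a common left factor on it respects all old equations.\<close>
    define C where "C = {x. \<exists>ss. walk M F v ss x}"
    have C: "src M f \<in> C \<longleftrightarrow> tgt M f \<in> C" if f: "f \<in> F" for f
    proof
      assume "src M f \<in> C"
      then obtain ss where "walk M F v ss (src M f)" by (auto simp: C_def)
      then have "walk M F v (ss @ [(f, True)]) (tgt M f)"
        using f by (auto simp: walk_append step_start_def step_end_def)
      then show "tgt M f \<in> C" by (auto simp: C_def)
    next
      assume "tgt M f \<in> C"
      then obtain ss where "walk M F v ss (tgt M f)" by (auto simp: C_def)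
      then have "walk M F v (ss @ [(f, False)]) (src M f)"
        using f by (auto simp: walk_append step_start_def step_end_def)
      then show "src M f \<in> C" by (auto simp: C_def)
    qed
    have v: "v \<in> C" by (auto simp: C_def intro: exI[of _ "[]"])
    have u: "u \<notin> C" using False by (auto simp: C_def)
    \<comment> \<open>The left factor forced by the equation for \<open>e\<close>. Gains act on the
      right, so translating on the left does not interfere with them.\<close>
    define c where "c = \<theta> u \<otimes> \<psi> e \<otimes> inv \<theta> v"
    have c: "c \<in> carrier G" "c \<otimes> \<theta> v = \<theta> u \<otimes> \<psi> e"
      using \<theta> \<psi> by (auto simp: c_def m_assoc)
    define \<theta>' where "\<theta>' x = (if x \<in> C then c \<otimes> \<theta> x else \<theta> x)" for x
    have "\<theta>' (src M f) \<otimes> \<psi> f = \<theta>' (tgt M f)" if f: "f \<in> insert e F" for f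
    proof (cases "f = e")
      case True
      then show ?thesis using u v c by (simp add: \<theta>'_def u_def[symmetric] v_def[symmetric])
    next
      case False
      with f have f: "f \<in> F" by simp
      show ?thesis
        unfolding \<theta>'_def using C[OF f] pot[OF f]
        by (simp add: m_assoc c(1) \<theta> \<psi>(2)[OF f])
    qed
    moreover have "\<theta>' x \<in> carrier G" for x using c \<theta> by (simp add: \<theta>'_def)
    ultimately show ?thesis by blast
  qed
qed

end

section \<open>The symmetric rigidity map\<close>

lemma sum_2: "(\<Sum>i\<in>(UNIV :: 2 set). f i) = f 1 + f 2"
  by (simp add: UNIV_2)

lemma vec_2_eq_iff: "x = y \<longleftrightarrow> x $ 1 = y $ 1 \<and> x $ 2 = y $ 2" for x y :: "'a ^ 2"
  by (simp add: vec_eq_iff forall_2)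

lemma reflection_sq: "reflection_y_axis ** reflection_y_axis = mat 1"
  by (simp add: reflection_y_axis_def vec_2_eq_iff matrix_matrix_mult_def mat_def sum_2)

lemma reflection_mult: "reflection_y_axis *v x = vector [- (x $ 1), x $ 2]"
  by (simp add: reflection_y_axis_def vec_2_eq_iff matrix_vector_mult_def sum_2)

lemma complex_reflection_mult:
  "complex_mat reflection_y_axis *v x = vector [- (x $ 1), x $ 2]"
  by (simp add: reflection_y_axis_def complex_mat_def vec_2_eq_iff matrix_vector_mult_def sum_2)

lemma complex_mat_one: "complex_mat (mat 1) = mat 1"
  by (simp add: complex_mat_def vec_eq_iff mat_def)

context cs_framework
begin

section \<open>The group of order two and its action on vertices and edges\<close>

lemma group_\<Gamma>: "group \<Gamma>"
  using group_hom by (simp add: group_hom_def)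

definition gen :: 'g where
  "gen = (SOME g. g \<in> carrier \<Gamma> \<and> g \<noteq> \<one>)"

definition mirror :: "'a \<Rightarrow> 'a" where
  "mirror v = \<phi> gen v"

lemma gen: "carrier \<Gamma> = {\<one>, gen}" "gen \<noteq> \<one>"
proof -
  have one: "\<one> \<in> carrier \<Gamma>"
    using group_\<Gamma> by (simp add: group.is_monoid monoid.one_closed)
  have card: "card (carrier \<Gamma>) = 2"
    using order_two by (simp add: order_def)
  then obtain x y where xy: "carrier \<Gamma> = {x, y}" "x \<noteq> y" by (auto simp: card_2_iff)
  define g where "g = (if x = \<one> then y else x)"
  have "carrier \<Gamma> = {\<one>, g}" "g \<noteq> \<one>"
    using xy one by (auto simp: g_def)
  moreover from this have "gen = g"
    unfolding gen_def by (intro some_equality) auto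
  ultimately show "carrier \<Gamma> = {\<one>, gen}" "gen \<noteq> \<one>" by auto
qed

lemma gen_closed: "gen \<in> carrier \<Gamma>"
  by (simp add: gen)

lemma gen_gen: "gen \<otimes> gen = \<one>"
proof -
  interpret group \<Gamma> by (rule group_\<Gamma>)
  have "gen \<otimes> gen \<in> {\<one>, gen}" using gen_closed gen(1) by blast
  moreover have "gen \<otimes> gen \<noteq> gen" using gen(2) gen_closed by (metis r_cancel_one)
  ultimately show ?thesis by blast
qed

lemma tau_one: "\<tau> \<one> = mat 1"
proof -
  interpret group \<Gamma> by (rule group_\<Gamma>)
  have "\<tau> \<one> = \<tau> \<one> ** \<tau> \<one>" using rep_mult[of \<one> \<one>] by simp
  moreover have "\<tau> \<one> \<in> {mat 1, reflection_y_axis}" using rep_image by blast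
  ultimately show ?thesis using reflection_sq by auto
qed

lemma tau_gen: "\<tau> gen = reflection_y_axis"
proof -
  have "\<tau> gen \<in> {mat 1, reflection_y_axis}" using rep_image gen_closed by blast
  moreover have "\<tau> gen \<noteq> \<tau> \<one>"
    using rep_faithful gen by (auto simp: inj_on_def)
  ultimately show ?thesis using tau_one by auto
qed

lemma phi_one: "v \<in> V \<Longrightarrow> \<phi> \<one> v = v"
  using id_eq_one by (metis restrict_apply')

lemma mirror_mem: "v \<in> V \<Longrightarrow> mirror v \<in> V"
  unfolding mirror_def using element_image gen_closed by blast

lemma mirror_mirror: "v \<in> V \<Longrightarrow> mirror (mirror v) = v"
  unfolding mirror_def using composition_rule[OF _ gen_closed gen_closed, of v]
  by (simp add: gen_gen phi_one)

lemma placement_mirror: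
  assumes "v \<in> V"
  shows "p (mirror v) $ 1 = - (p v $ 1)" "p (mirror v) $ 2 = p v $ 2"
  using placement_sym[OF gen_closed assms, symmetric]
  by (simp_all add: mirror_def tau_gen reflection_mult)

text \<open>The reflection negates the first coordinate, and injectivity of \<open>p\<close> turns
  equal positions into equal vertices: fixed vertices are those on the mirror line.\<close>

lemma mirror_fixed_iff: "v \<in> V \<Longrightarrow> mirror v = v \<longleftrightarrow> p v $ 1 = 0"
  using placement_mirror[of v] placement_inj mirror_mem[of v]
  by (auto simp: inj_on_def vec_2_eq_iff)

lemma fixed_iff: "v \<in> V \<Longrightarrow> fixed v \<longleftrightarrow> mirror v = v"
  by (auto simp: fixed_def stabilizer_def gen mirror_def phi_one)

lemma orbit_eq: "v \<in> V \<Longrightarrow> orbit \<Gamma> \<phi> v = {v, mirror v}"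
  unfolding orbit_def Setcompr_eq_image gen(1) by (simp add: mirror_def phi_one)

lemma placement_ne: "u \<in> V \<Longrightarrow> v \<in> V \<Longrightarrow> u \<noteq> v \<Longrightarrow> p u $ 1 \<noteq> p v $ 1 \<or> p u $ 2 \<noteq> p v $ 2"
  using placement_inj by (auto simp: inj_on_def vec_2_eq_iff)

text \<open>Otherwise all joints would lie on the mirror line, whose affine hull is not the plane.
  This supplies an orbit to pin on the whole graph.\<close>

lemma exists_off_axis: "\<exists>v\<in>V. p v $ 1 \<noteq> 0"
proof (rule ccontr)
  assume "\<not> ?thesis"
  then have "p ` V \<subseteq> {x. x \<bullet> axis 1 1 = 0}" by (auto simp: inner_axis)
  moreover have "affine {x :: real^2. x \<bullet> axis 1 1 = 0}"
    using affine_hyperplane[of "axis 1 1 :: real^2" 0] by (simp add: inner_commute)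
  ultimately have "affine hull (p ` V) \<subseteq> {x. x \<bullet> axis 1 1 = 0}"
    by (rule hull_minimal)
  then have "axis 1 1 \<bullet> (axis 1 1 :: real^2) = 0" using placement_spans by blast
  then show False by (simp add: inner_axis_axis)
qed

lemma edge_ends:
  assumes "e \<in> E"
  obtains u v where "e = {u, v}" "u \<noteq> v" "u \<in> V" "v \<in> V"
  using simple[OF assms] by (auto simp: card_2_iff)

lemma edge_pair: "{u, v} \<in> E \<Longrightarrow> u \<in> V \<and> v \<in> V \<and> u \<noteq> v"
  using simple[of "{u, v}"] by (auto simp: card_insert_if split: if_splits)

lemma finite_edges: "finite E"
  using finite_subset[of E "Pow V"] finite_verts simple by blast

lemma mirror_edge: "e \<in> E \<Longrightarrow> mirror ` e \<in> E"
  using automorphism[OF gen_closed] by (simp add: mirror_def[abs_def])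

lemma mirror_mirror_edge: "e \<in> E \<Longrightarrow> mirror ` mirror ` e = e"
  by (elim edge_ends) (simp add: mirror_mirror)

lemma edge_action_one: "e \<in> E \<Longrightarrow> edge_action \<one> e = e"
  by (elim edge_ends) (simp add: edge_action_def phi_one)

lemma edge_action_gen: "edge_action gen e = mirror ` e"
  by (simp add: edge_action_def mirror_def[abs_def])

lemma edge_orbit_eq: "e \<in> E \<Longrightarrow> orbit \<Gamma> edge_action e = {e, mirror ` e}"
  unfolding orbit_def Setcompr_eq_image gen(1) by (simp add: edge_action_one edge_action_gen)

lemma edges_free_iff: "edges_free \<longleftrightarrow> (\<forall>e\<in>E. mirror ` e \<noteq> e)"
proof -
  have "stabilizer \<Gamma> edge_action e = {\<one>} \<longleftrightarrow> mirror ` e \<noteq> e" if "e \<in> E" for e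
    using that gen(2) edge_action_one[OF that] edge_action_gen[of e]
    unfolding stabilizer_def gen(1) by auto
  then show ?thesis by (simp add: edges_free_def)
qed

text \<open>The condition for the identity is vacuous, and the character values are real, so
  conjugation disappears.\<close>

lemma sym_motion_iff:
  "m \<in> sym_motion_space j \<longleftrightarrow> (\<forall>v. v \<notin> V \<longrightarrow> m v = 0) \<and>
    (\<forall>v\<in>V. m (mirror v) $ 1 = - ((-1) ^ j * m v $ 1) \<and> m (mirror v) $ 2 = (-1) ^ j * m v $ 2)"
  by (auto simp: sym_motion_space_def gen irrep_def tau_one tau_gen complex_mat_one phi_one
      complex_reflection_mult mirror_def vec_2_eq_iff)

lemma sym_edge_iff:
  "w \<in> sym_edge_space j \<longleftrightarrow> (\<forall>e. e \<notin> E \<longrightarrow> w e = 0) \<and> (\<forall>e\<in>E. w (mirror ` e) = (-1) ^ j * w e)"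
  by (auto simp: sym_edge_space_def gen irrep_def edge_action_one edge_action_gen)

section \<open>The rigidity map in coordinates, its linearity and its image\<close>

lemma rigidity_map_edge:
  assumes "{u, v} \<in> E"
  shows "rigidity_map m {u, v} =
    (\<Sum>i\<in>UNIV. complex_of_real (p u $ i - p v $ i) * (m u $ i - m v $ i))"
proof -
  define f where
    "f u v = (\<Sum>i\<in>UNIV. complex_of_real (p u $ i - p v $ i) * (m u $ i - m v $ i))" for u v
  \<comment> \<open>Exchanging the ends changes two signs in each summand, so the definite
    description has a unique value.\<close>
  have sym: "f a b = f b a" for a b
    unfolding f_def by (intro sum.cong) (auto simp: algebra_simps)
  have "rigidity_map m {u, v} = (THE x. \<exists>a b. {u, v} = {a, b} \<and> x = f a b)"
    using assms by (simp add: rigidity_map_def complex_vec_def f_def)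
  also have "\<dots> = f u v"
    by (rule the_equality) (auto simp: doubleton_eq_iff sym[of v u])
  finally show ?thesis by (simp add: f_def)
qed

lemma rigidity_map_outside: "e \<notin> E \<Longrightarrow> rigidity_map m e = 0"
  by (simp add: rigidity_map_def)

text \<open>One choice of ends serves all motions at once, which is what linearity in
  \<open>m\<close> requires.\<close>

lemma rigidity_map_ends:
  assumes "e \<in> E"
  obtains u v where "e = {u, v}" "u \<in> V" "v \<in> V"
    "\<And>m. rigidity_map m e = complex_of_real (p u $ 1 - p v $ 1) * (m u $ 1 - m v $ 1) +
      complex_of_real (p u $ 2 - p v $ 2) * (m u $ 2 - m v $ 2)"
proof -
  obtain u v where e: "e = {u, v}" "u \<in> V" "v \<in> V" using edge_ends[OF assms] .
  with assms have "{u, v} \<in> E" by simp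
  from rigidity_map_edge[OF this] show ?thesis
    by (intro that[OF e]) (simp add: e sum_2)
qed

lemma linear_rigidity_map: "Vector_Spaces.linear motion_scale edge_scale rigidity_map"
proof -
  have add: "rigidity_map (m + n) e = rigidity_map m e + rigidity_map n e" for m n e
  proof (cases "e \<in> E")
    case True
    then obtain u v where rm: "\<And>m. rigidity_map m e =
        complex_of_real (p u $ 1 - p v $ 1) * (m u $ 1 - m v $ 1) +
        complex_of_real (p u $ 2 - p v $ 2) * (m u $ 2 - m v $ 2)"
      using rigidity_map_ends by metis
    show ?thesis unfolding rm by (simp add: algebra_simps)
  qed (simp add: rigidity_map_outside)
  have scale: "rigidity_map (motion_scale c m) e = c * rigidity_map m e" for c m e
  proof (cases "e \<in> E")
    case True
    then obtain u v where rm: "\<And>m. rigidity_map m e =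
        complex_of_real (p u $ 1 - p v $ 1) * (m u $ 1 - m v $ 1) +
        complex_of_real (p u $ 2 - p v $ 2) * (m u $ 2 - m v $ 2)"
      using rigidity_map_ends by metis
    show ?thesis unfolding rm by (simp add: motion_scale_def algebra_simps)
  qed (simp add: rigidity_map_outside)
  show ?thesis
    by unfold_locales (auto simp: add scale fun_eq_iff edge_scale_def)
qed

text \<open>Independence of the rows is used dually: a functional on \<open>sym_edge_space j\<close> that vanishes
  on the image of the rigidity map would be a row dependence.\<close>

lemma rigidity_map_surj:
  assumes "symmetrically_isostatic j" and w: "w \<in> sym_edge_space j"
  obtains m where "m \<in> sym_motion_space j" "rigidity_map m = w"
proof -
  interpret R: Vector_Spaces.linear motion_scale edge_scale rigidity_map
    by (rule linear_rigidity_map)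
  obtain B C A where block: "is_rigidity_block j B C A"
    and rows: "\<And>r b. (\<forall>c\<in>C. (\<Sum>b\<in>B. r b * A b c) = 0) \<Longrightarrow> b \<in> B \<Longrightarrow> r b = 0"
    using assms(1) unfolding symmetrically_isostatic_def by blast
  have B: "edge.span B = sym_edge_space j" and C: "motion.span C = sym_motion_space j"
    and A: "\<And>c. c \<in> C \<Longrightarrow> rigidity_map c = (\<Sum>b\<in>B. edge_scale (A b c) b)"
    using block by (auto simp: is_rigidity_block_def)
  have "w \<in> edge.span (rigidity_map ` C)"
  proof (rule ccontr)
    assume not: "w \<notin> edge.span (rigidity_map ` C)"
    obtain D where D: "D \<subseteq> rigidity_map ` C" "edge.independent D"
      "rigidity_map ` C \<subseteq> edge.span D"
      by (rule edge.maximal_independent_subset)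
    have "w \<notin> edge.span D" using not D(1) edge.span_mono by blast
    then have ind: "edge.independent (insert w D)" using D(2) by (simp add: edge.independent_insertI)
    interpret pair: vector_space_pair edge_scale "(*) :: complex \<Rightarrow> complex \<Rightarrow> complex"
      by unfold_locales (auto simp: algebra_simps)
    \<comment> \<open>\<open>f\<close> is \<open>1\<close> at \<open>w\<close> and \<open>0\<close>
      on the basis \<open>D\<close> of the image; its values on \<open>B\<close> are the
      coefficients of the row dependence.\<close>
    obtain f where f: "Vector_Spaces.linear edge_scale ((*) :: complex \<Rightarrow> _) f"
      "\<And>x. x \<in> insert w D \<Longrightarrow> f x = (if x = w then 1 else 0)"
      using pair.linear_independent_extend[OF ind, of "\<lambda>x. if x = w then 1 else 0"] by blast
    interpret f: Vector_Spaces.linear edge_scale "(*) :: complex \<Rightarrow> complex \<Rightarrow> complex" f by fact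
    have "f x = 0" if "x \<in> D" for x
      using f(2)[of x] that \<open>w \<notin> edge.span D\<close> edge.span_base[of x D] by auto
    then have "f x = 0" if "x \<in> edge.span D" for x
      using f.eq_0_on_span that by blast
    then have "f (rigidity_map c) = 0" if "c \<in> C" for c using D(3) that by blast
    then have "\<forall>c\<in>C. (\<Sum>b\<in>B. f b * A b c) = 0"
      using A by (simp add: f.sum f.scale mult.commute)
    then have "f b = 0" if "b \<in> B" for b using rows that by blast
    then have "f x = 0" if "x \<in> edge.span B" for x using f.eq_0_on_span that by blast
    then have "f w = 0" using w B by simp
    then show False using f(2)[of w] by simp
  qed
  also have "\<dots> = rigidity_map ` sym_motion_space j" by (simp add: R.span_image C)
  finally show ?thesis using that by blast
qed

section \<open>Infinitesimal rigid motions of the plane\<close>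

definition rigid_motion :: "complex \<Rightarrow> complex \<Rightarrow> complex \<Rightarrow> 'a \<Rightarrow> complex^2" where
  "rigid_motion a b c v = (if v \<in> V then vector [a - c * p v $ 2, b + c * p v $ 1] else 0)"

lemma rigid_motion_nth:
  "v \<in> V \<Longrightarrow> rigid_motion a b c v $ 1 = a - c * p v $ 2"
  "v \<in> V \<Longrightarrow> rigid_motion a b c v $ 2 = b + c * p v $ 1"
  by (simp_all add: rigid_motion_def)

text \<open>The translation \<open>(a, b)\<close> cancels in differences, and the rotation with
  speed \<open>c\<close> gives each edge a velocity difference perpendicular to it.\<close>

lemma rigidity_map_rigid_motion: "rigidity_map (rigid_motion a b c) = 0"
proof
  fix e show "rigidity_map (rigid_motion a b c) e = 0 e"
  proof (cases "e \<in> E")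
    case True
    then obtain u v where uv: "u \<in> V" "v \<in> V" and rm: "\<And>m. rigidity_map m e =
        complex_of_real (p u $ 1 - p v $ 1) * (m u $ 1 - m v $ 1) +
        complex_of_real (p u $ 2 - p v $ 2) * (m u $ 2 - m v $ 2)"
      using rigidity_map_ends by metis
    show ?thesis unfolding rm by (simp add: rigid_motion_nth uv algebra_simps)
  qed (simp add: rigidity_map_outside)
qed

lemma rigidity_map_add_rigid_motion:
  "rigidity_map (m + rigid_motion a b c) = rigidity_map m"
proof -
  interpret R: Vector_Spaces.linear motion_scale edge_scale rigidity_map
    by (rule linear_rigidity_map)
  show ?thesis by (simp add: R.add rigidity_map_rigid_motion)
qed

text \<open>In dimension two a skew-symmetric matrix has zero diagonal and is determined by its
  lower left entry, the speed of rotation.\<close>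

lemma trivial_motion_rigid:
  assumes "trivial_motion m"
  obtains a b c where "\<And>v. v \<in> V \<Longrightarrow> m v = rigid_motion a b c v"
proof -
  from assms obtain M t where M: "transpose M = - M"
    and m: "\<And>u. u \<in> V \<Longrightarrow> m u = M *v complex_vec (p u) + t"
    unfolding trivial_motion_def by blast
  have skew: "M $ i $ k = - (M $ k $ i)" for i k
    using arg_cong[OF M, of "\<lambda>N. N $ k $ i"] by (simp add: transpose_def)
  have "M $ 1 $ 1 = 0" "M $ 2 $ 2 = 0" "M $ 1 $ 2 = - (M $ 2 $ 1)"
    using skew[of 1 1] skew[of 2 2] skew[of 1 2] by auto
  then have "m v = rigid_motion (t $ 1) (t $ 2) (M $ 2 $ 1) v" if "v \<in> V" for v
    using that by (simp add: m rigid_motion_def vec_2_eq_iff matrix_vector_mult_def sum_2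
        complex_vec_def algebra_simps)
  then show ?thesis by (rule that)
qed

end

section \<open>Counting on the quotient\<close>

context cs_gain_framework
begin

section \<open>Vertex and edge orbits as mirror pairs\<close>

lemma vert_mem:
  assumes "x \<in> verts G" "v \<in> x"
  shows "v \<in> V" "x = {v, mirror v}"
proof -
  from assms(1) obtain u where "u \<in> V" "x = {u, mirror u}"
    by (auto simp: verts_eq orbits_def orbit_eq)
  with assms(2) show "v \<in> V" "x = {v, mirror v}"
    by (auto simp: mirror_mem mirror_mirror)
qed

lemma vert_of: "v \<in> V \<Longrightarrow> {v, mirror v} \<in> verts G"
  using orbit_eq[of v] by (auto simp: verts_eq orbits_def)

lemma rep_V: "x \<in> verts G \<Longrightarrow> rep x \<in> V"
  using vert_mem rep_mem by blast

lemma vert_rep: "x \<in> verts G \<Longrightarrow> x = {rep x, mirror (rep x)}"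
  using vert_mem rep_mem by blast

lemma fixed_vert_iff:
  assumes "x \<in> verts G" "v \<in> x"
  shows "x \<in> fixed_verts G \<longleftrightarrow> mirror v = v"
proof
  assume "x \<in> fixed_verts G"
  then obtain u where "u \<in> V" "mirror u = u" "x = {u, mirror u}"
    by (auto simp: fixed_verts_eq orbits_def orbit_eq fixed_iff)
  with assms show "mirror v = v" by auto
next
  assume "mirror v = v"
  then have "x = orbit \<Gamma> \<phi> v" "v \<in> V" "fixed v"
    using vert_mem[OF assms] by (auto simp: orbit_eq fixed_iff)
  then show "x \<in> fixed_verts G"
    unfolding fixed_verts_eq orbits_def by blast
qed

lemma finite_vertsG: "finite (verts G)"
proof -
  have "verts G = (\<lambda>v. orbit \<Gamma> \<phi> v) ` V" by (auto simp: verts_eq orbits_def)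
  then show ?thesis using finite_verts by simp
qed

lemma finite_edgesG: "finite (edges G)"
proof -
  have "edges G = (\<lambda>d. orbit \<Gamma> edge_action d) ` E" by (auto simp: edges_eq orbits_def)
  then show ?thesis using finite_edges by simp
qed

lemma edge_mem:
  assumes "e \<in> edges G" "d \<in> e"
  shows "d \<in> E" "e = {d, mirror ` d}"
proof -
  from assms(1) obtain c where "c \<in> E" "e = {c, mirror ` c}"
    by (auto simp: edges_eq orbits_def edge_orbit_eq)
  note c = this
  from assms(2) c(2) consider "d = c" | "d = mirror ` c" by blast
  then show "d \<in> E" "e = {d, mirror ` d}"
    by (cases; simp add: c mirror_edge mirror_mirror_edge insert_commute)+
qed

lemma edge_of: "d \<in> E \<Longrightarrow> {d, mirror ` d} \<in> edges G"
  using edge_orbit_eq[of d] by (auto simp: edges_eq orbits_def)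

lemma edge_nonempty: "e \<in> edges G \<Longrightarrow> \<exists>d. d \<in> e"
  by (auto simp: edges_eq orbits_def edge_orbit_eq)

lemma edge_class_mirror: "d \<in> E \<Longrightarrow> {mirror ` d, mirror ` mirror ` d} = {d, mirror ` d}"
  by (simp add: mirror_mirror_edge insert_commute)

lemma ends_verts:
  assumes "e \<in> edges G"
  shows "src G e \<in> verts G" "tgt G e \<in> verts G"
proof -
  from ends[OF assms] obtain u v where uv: "{u, v} \<in> e" "src G e = orbit \<Gamma> \<phi> u"
    "tgt G e = orbit \<Gamma> \<phi> v" by blast
  have "u \<in> V" "v \<in> V" using edge_pair edge_mem(1)[OF assms uv(1)] by blast+
  with uv show "src G e \<in> verts G" "tgt G e \<in> verts G" by (auto simp: verts_eq orbits_def)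
qed

text \<open>\<open>ends\<close> treats only one member of the edge orbit; any other member is its
  mirror image, whose ends lie in the same vertex orbits.\<close>

lemma edge_ends_mem:
  assumes "e \<in> edges G" "d \<in> e"
  obtains u v where "d = {u, v}" "u \<noteq> v" "u \<in> src G e" "v \<in> tgt G e"
proof -
  from ends[OF assms(1)] obtain u v where uv: "{u, v} \<in> e" "src G e = orbit \<Gamma> \<phi> u"
    "tgt G e = orbit \<Gamma> \<phi> v" by blast
  have ne: "u \<in> V" "v \<in> V" "u \<noteq> v" using edge_pair edge_mem(1)[OF assms(1) uv(1)] by blast+
  have "d = {u, v} \<or> d = {mirror u, mirror v}"
    using edge_mem(2)[OF assms(1) uv(1)] assms(2) by auto
  moreover have "mirror u \<noteq> mirror v" using ne mirror_mirror by metis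
  ultimately show thesis
    using that[of u v] that[of "mirror u" "mirror v"] uv ne by (auto simp: orbit_eq)
qed

section \<open>Coordinates of symmetric motions on the quotient\<close>

definition free_coord :: "nat \<Rightarrow> 2" where
  "free_coord j = (if even j then 2 else 1)"

text \<open>At a fixed orbit the symmetry forces one coordinate to vanish: the horizontal one for
  even \<open>j\<close>, the vertical one for odd \<open>j\<close>. Only \<open>free_coord j\<close>
  remains there.\<close>

definition coords :: "nat \<Rightarrow> 'a set set \<Rightarrow> ('a set \<times> 2) set" where
  "coords j VH = {(x, i). x \<in> VH \<and> (x \<in> fixed_verts G \<longrightarrow> i = free_coord j)}"

lemma finite_coords: "VH \<subseteq> verts G \<Longrightarrow> finite (coords j VH)"
  using finite_subset[of "coords j VH" "verts G \<times> UNIV"] finite_vertsG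
  by (auto simp: coords_def)

lemma card_coords:
  assumes "VH \<subseteq> verts G"
  shows "card (coords j VH) = 2 * card (VH - fixed_verts G) + card (VH \<inter> fixed_verts G)"
proof -
  have fin: "finite VH" using assms finite_vertsG finite_subset by blast
  have "coords j VH = (VH - fixed_verts G) \<times> UNIV \<union> (VH \<inter> fixed_verts G) \<times> {free_coord j}"
    by (auto simp: coords_def)
  also have "card \<dots> = card ((VH - fixed_verts G) \<times> (UNIV :: 2 set)) +
      card ((VH \<inter> fixed_verts G) \<times> {free_coord j})"
    using fin by (intro card_Un_disjoint) auto
  finally show ?thesis by (simp add: card_cartesian_product)
qed

text \<open>The values at the representatives are carried to the other vertex of a free orbit by the
  reflection and the sign of the character.\<close>

definition lift_motion :: "nat \<Rightarrow> ('a set \<times> 2 \<Rightarrow> complex) \<Rightarrow> 'a \<Rightarrow> complex^2" where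
  "lift_motion j z v = (if v \<notin> V then 0
     else let x = {v, mirror v} in
       if v = rep x then vector [z (x, 1), z (x, 2)]
       else vector [- ((-1) ^ j * z (x, 1)), (-1) ^ j * z (x, 2)])"

lemma sign_sq: "(-1) ^ j * ((-1) ^ j * a) = (a :: complex)"
  by (simp add: mult.assoc[symmetric] power_add[symmetric])

lemma lift_motion_rep:
  assumes "x \<in> verts G"
  shows "lift_motion j z (rep x) $ i = z (x, i)"
proof -
  have "i = 1 \<or> i = 2" by (rule exhaust_2)
  then show ?thesis
    using rep_V[OF assms] by (auto simp: lift_motion_def Let_def vert_rep[OF assms, symmetric])
qed

text \<open>On free orbits the symmetry is built into the lift; on fixed orbits it demands that the
  coordinate missing from \<open>coords\<close> be zero, which the support condition gives.\<close>

lemma lift_motion_sym: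
  assumes VH: "VH \<subseteq> verts G" and z: "\<forall>k. k \<notin> coords j VH \<longrightarrow> z k = 0"
  shows "lift_motion j z \<in> sym_motion_space j"
proof -
  have "lift_motion j z (mirror v) $ 1 = - ((-1) ^ j * lift_motion j z v $ 1) \<and>
      lift_motion j z (mirror v) $ 2 = (-1) ^ j * lift_motion j z v $ 2" if v: "v \<in> V" for v
  proof -
    define x where "x = {v, mirror v}"
    have x: "x \<in> verts G" "v \<in> x" using vert_of[OF v] by (auto simp: x_def)
    have x': "x = {mirror v, mirror (mirror v)}" using v by (auto simp: x_def mirror_mirror)
    note m = mirror_mem[OF v]
    show ?thesis
    proof (cases "mirror v = v")
      case True
      then have "x \<in> fixed_verts G" using fixed_vert_iff[OF x] by simp
      then have "even j \<Longrightarrow> z (x, 1) = 0" "odd j \<Longrightarrow> z (x, 2) = 0"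
        using z by (auto simp: coords_def free_coord_def)
      moreover have "rep x = v" using rep_mem[OF x(1)] True by (auto simp: x_def)
      ultimately show ?thesis using lift_motion_rep[OF x(1), of j z] True
        by (cases "even j") auto
    next
      case False
      have "rep x = v \<or> rep x = mirror v" using rep_mem[OF x(1)] by (auto simp: x_def)
      then show ?thesis
        using False v m unfolding lift_motion_def x'[symmetric] x_def[symmetric] Let_def
        by (auto simp: sign_sq)
    qed
  qed
  then show ?thesis by (auto simp: sym_motion_iff lift_motion_def)
qed

definition proj_motion :: "nat \<Rightarrow> 'a set set \<Rightarrow> ('a \<Rightarrow> complex^2) \<Rightarrow> 'a set \<times> 2 \<Rightarrow> complex" where
  "proj_motion j VH m k = (if k \<in> coords j VH then m (rep (fst k)) $ snd k else 0)"

text \<open>Dropping the coordinates outside \<open>coords\<close> loses nothing, because symmetry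
  makes them vanish at fixed vertices.\<close>

lemma proj_motion_nth:
  assumes VH: "VH \<subseteq> verts G" "x \<in> VH" and m: "m \<in> sym_motion_space j"
  shows "proj_motion j VH m (x, i) = m (rep x) $ i"
proof (cases "(x, i) \<in> coords j VH")
  case False
  then have fx: "x \<in> fixed_verts G" and i: "i \<noteq> free_coord j" using VH by (auto simp: coords_def)
  have x: "x \<in> verts G" using VH by auto
  have "mirror (rep x) = rep x" using fx fixed_vert_iff[OF x rep_mem[OF x]] by simp
  then have "m (rep x) $ 1 = - ((-1) ^ j * m (rep x) $ 1)"
    "m (rep x) $ 2 = (-1) ^ j * m (rep x) $ 2"
    using m rep_V[OF x] by (auto simp: sym_motion_iff dest!: bspec[of _ _ "rep x"])
  moreover have "i = 1 \<or> i = 2" by (rule exhaust_2)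
  ultimately have "m (rep x) $ i = 0"
    using i by (cases "even j") (auto simp: free_coord_def)
  then show ?thesis using False by (simp add: proj_motion_def)
qed (simp add: proj_motion_def)

lemma lift_proj_motion:
  assumes VH: "VH \<subseteq> verts G" "x \<in> VH" and v: "v \<in> x" and m: "m \<in> sym_motion_space j"
  shows "lift_motion j (proj_motion j VH m) v = m v"
proof -
  have x: "x \<in> verts G" using VH by auto
  have vV: "v \<in> V" and xv: "{v, mirror v} = x" using vert_mem[OF x v] by auto
  show ?thesis
  proof (cases "v = rep x")
    case True
    then show ?thesis
      by (simp add: vec_2_eq_iff lift_motion_rep[OF x] proj_motion_nth[OF VH m])
  next
    case False
    then have "v = mirror (rep x)" using v vert_rep[OF x] by auto
    then have "m v $ 1 = - ((-1) ^ j * m (rep x) $ 1)" "m v $ 2 = (-1) ^ j * m (rep x) $ 2"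
      using m rep_V[OF x] by (simp_all add: sym_motion_iff)
    then show ?thesis
      unfolding lift_motion_def xv Let_def
      using False vV by (simp add: vec_2_eq_iff proj_motion_nth[OF VH m])
  qed
qed

text \<open>Edge values and single coordinates are put into one linear map, so that restricting to a
  disjoint sum prescribes edges and pinned coordinates together. \<open>\<epsilon>\<close> picks one
  edge from each orbit.\<close>

definition constraint_map ::
    "nat \<Rightarrow> ('a set set \<Rightarrow> 'a set) \<Rightarrow> ('a set \<times> 2 \<Rightarrow> complex) \<Rightarrow> 'a set set + 'a set \<times> 2 \<Rightarrow> complex"
  where "constraint_map j \<epsilon> z = case_sum (\<lambda>e. rigidity_map (lift_motion j z) (\<epsilon> e)) z"

lemma linear_constraint_map: "Vector_Spaces.linear edge_scale edge_scale (constraint_map j \<epsilon>)"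
proof -
  interpret R: Vector_Spaces.linear motion_scale edge_scale rigidity_map
    by (rule linear_rigidity_map)
  have add: "lift_motion j (y + z) = lift_motion j y + lift_motion j z" for y z
    by (auto simp: fun_eq_iff lift_motion_def Let_def vec_2_eq_iff algebra_simps)
  have scale: "lift_motion j (edge_scale c z) = motion_scale c (lift_motion j z)" for c z
    by (auto simp: fun_eq_iff lift_motion_def Let_def vec_2_eq_iff edge_scale_def motion_scale_def)
  show ?thesis
  proof (unfold_locales)
    fix y z :: "'a set \<times> 2 \<Rightarrow> complex" and c
    show "constraint_map j \<epsilon> (y + z) = constraint_map j \<epsilon> y + constraint_map j \<epsilon> z"
      unfolding constraint_map_def add R.add by (auto simp: fun_eq_iff split: sum.splits)
    show "constraint_map j \<epsilon> (edge_scale c z) = edge_scale c (constraint_map j \<epsilon> z)"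
      unfolding constraint_map_def scale R.scale
      by (auto simp: fun_eq_iff edge_scale_def split: sum.splits)
  qed
qed

text \<open>For odd \<open>j\<close> a value prescribed on one edge of an orbit extends antisymmetrically to the
  orbit only if the orbit has two edges.\<close>

lemma rigidity_map_surj_quotient:
  assumes iso: "symmetrically_isostatic j" and free: "even j \<or> edges_free"
    and \<epsilon>: "\<And>e. e \<in> edges G \<Longrightarrow> \<epsilon> e \<in> e"
  obtains m where "m \<in> sym_motion_space j" "\<And>e. e \<in> edges G \<Longrightarrow> rigidity_map m (\<epsilon> e) = w e"
proof -
  \<comment> \<open>The chosen edge of an orbit receives \<open>w\<close>; its mirror image receives
    \<open>w\<close> with the sign of the character.\<close>
  define W :: "'a set \<Rightarrow> complex" where
    "W d = (if d \<in> E then (if even j \<or> d = \<epsilon> {d, mirror ` d} then 1 else -1) * w {d, mirror ` d}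
      else 0)" for d
  have "W (mirror ` d) = (-1) ^ j * W d" if d: "d \<in> E" for d
  proof (cases "even j")
    case True
    then show ?thesis using d by (simp add: W_def mirror_edge edge_class_mirror)
  next
    case False
    then have "mirror ` d \<noteq> d" using free d by (simp add: edges_free_iff)
    moreover have "\<epsilon> {d, mirror ` d} = d \<or> \<epsilon> {d, mirror ` d} = mirror ` d"
      using \<epsilon>[OF edge_of[OF d]] by auto
    ultimately show ?thesis using False d
      by (auto simp: W_def mirror_edge edge_class_mirror)
  qed
  then have "W \<in> sym_edge_space j" by (auto simp: sym_edge_iff W_def)
  then obtain m where m: "m \<in> sym_motion_space j" "rigidity_map m = W"
    using rigidity_map_surj[OF iso] by blast
  have "W (\<epsilon> e) = w e" if e: "e \<in> edges G" for e
    using edge_mem[OF e \<epsilon>[OF e]] by (simp add: W_def)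
  with m show ?thesis using that by metis
qed

section \<open>Edge counts for subgraphs and for the whole graph\<close>

lemma rigidity_map_cong:
  assumes "\<And>v. v \<in> d \<Longrightarrow> m v = n v" "d \<in> E"
  shows "rigidity_map m d = rigidity_map n d"
proof -
  obtain u v where uv: "d = {u, v}" and rm: "\<And>m. rigidity_map m d =
      complex_of_real (p u $ 1 - p v $ 1) * (m u $ 1 - m v $ 1) +
      complex_of_real (p u $ 2 - p v $ 2) * (m u $ 2 - m v $ 2)"
    using rigidity_map_ends[OF assms(2)] by metis
  show ?thesis unfolding rm using assms(1) uv by simp
qed

text \<open>The reflection preserves scalar products, so only the sign of the character remains.
  Hence one edge per orbit decides the whole orbit.\<close>

lemma rigidity_map_mirror:
  assumes m: "m \<in> sym_motion_space j" and d: "d \<in> E"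
  shows "rigidity_map m (mirror ` d) = (-1) ^ j * rigidity_map m d"
proof -
  obtain u v where uv: "d = {u, v}" "u \<in> V" "v \<in> V" using edge_ends[OF d] by blast
  have "{u, v} \<in> E" "{mirror u, mirror v} \<in> E"
    using d mirror_edge[OF d] uv by auto
  then show ?thesis
    using uv m by (simp add: rigidity_map_edge sum_2 placement_mirror sym_motion_iff algebra_simps)
qed

text \<open>Prescribed edge values are attained first; a symmetric rigid motion then corrects the
  coordinates in \<open>D\<close> without disturbing them. The map from \<open>coords j VH\<close>
  to \<open>EH <+> D\<close> is therefore onto.\<close>

lemma card_edges_plus_dofs_le:
  assumes iso: "symmetrically_isostatic j" and free: "even j \<or> edges_free"
    and H: "is_subgraph VH EH G" and D: "D \<subseteq> coords j VH"
    and rigid: "\<And>t. \<exists>a b c. rigid_motion a b c \<in> sym_motion_space j \<and>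
      (\<forall>(x, i)\<in>D. rigid_motion a b c (rep x) $ i = t (x, i))"
  shows "card EH + card D \<le> card (coords j VH)"
proof -
  have VH: "VH \<subseteq> verts G" and EH: "EH \<subseteq> edges G" using H by (auto simp: is_subgraph_def)
  define \<epsilon> where "\<epsilon> e = (SOME d. d \<in> e)" for e :: "'a set set"
  have \<epsilon>: "\<epsilon> e \<in> e" if "e \<in> edges G" for e
    unfolding \<epsilon>_def using edge_nonempty[OF that] by (rule someI_ex)
  have fin: "finite EH" "finite D"
    using EH D finite_edgesG finite_coords[OF VH] finite_subset by blast+
  have "card (EH <+> D) \<le> card (coords j VH)"
  proof (rule card_le_of_linear_surj[OF linear_constraint_map[of j \<epsilon>] finite_coords[OF VH]])
    show "finite (EH <+> D)" using fin by simp
    fix w :: "'a set set + 'a set \<times> 2 \<Rightarrow> complex"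
    obtain m where m: "m \<in> sym_motion_space j"
      "\<And>e. e \<in> edges G \<Longrightarrow> rigidity_map m (\<epsilon> e) = w (Inl e)"
      using rigidity_map_surj_quotient[OF iso free \<epsilon>, of "\<lambda>e. w (Inl e)"] by blast
    obtain a b c where r: "rigid_motion a b c \<in> sym_motion_space j"
      "\<forall>(x, i)\<in>D. rigid_motion a b c (rep x) $ i = w (Inr (x, i)) - m (rep x) $ i"
      using rigid[of "\<lambda>k. w (Inr k) - m (rep (fst k)) $ snd k"] by auto
    define n where "n = m + rigid_motion a b c"
    have n: "n \<in> sym_motion_space j"
      using m(1) r(1) by (auto simp: n_def sym_motion_iff algebra_simps)
    let ?z = "proj_motion j VH n"
    have "constraint_map j \<epsilon> ?z k = w k" if k: "k \<in> EH <+> D" for k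
    proof (cases k)
      case (Inl e)
      with k have e: "e \<in> EH" "e \<in> edges G" using EH by auto
      have d: "\<epsilon> e \<in> e" "\<epsilon> e \<in> E" using \<epsilon>[OF e(2)] edge_mem[OF e(2)] by auto
      obtain u v where uv: "\<epsilon> e = {u, v}" "u \<in> src G e" "v \<in> tgt G e"
        using edge_ends_mem[OF e(2) d(1)] by metis
      \<comment> \<open>Both ends of the edge lie in orbits of \<open>VH\<close>, so projecting to
        \<open>VH\<close> and lifting again keeps its value.\<close>
      have "src G e \<in> VH" "tgt G e \<in> VH" using H e(1) by (auto simp: is_subgraph_def)
      then have "rigidity_map (lift_motion j ?z) (\<epsilon> e) = rigidity_map n (\<epsilon> e)"
        using uv lift_proj_motion[OF VH _ _ n] d(2) by (intro rigidity_map_cong) auto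
      also have "\<dots> = w k" using m(2)[OF e(2)] Inl by (simp add: n_def rigidity_map_add_rigid_motion)
      finally show ?thesis by (simp add: constraint_map_def Inl)
    next
      case (Inr xi)
      obtain x i where xi: "xi = (x, i)" by fastforce
      with k Inr have "(x, i) \<in> D" by auto
      then have "x \<in> VH" "n (rep x) $ i = w (Inr (x, i))"
        using D r(2) by (auto simp: coords_def n_def)
      then show ?thesis
        using proj_motion_nth[OF VH _ n] by (simp add: constraint_map_def Inr xi)
    qed
    then show "\<exists>z. (\<forall>k. k \<notin> coords j VH \<longrightarrow> z k = 0) \<and>
        (\<forall>k\<in>EH <+> D. constraint_map j \<epsilon> z k = w k)"
      by (intro exI[of _ ?z]) (auto simp: proj_motion_def)
  qed
  then show ?thesis using fin by (simp add: card_Plus)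
qed

lemma rigid_motion_even: "even j \<Longrightarrow> rigid_motion 0 b 0 \<in> sym_motion_space j"
  by (auto simp: sym_motion_iff rigid_motion_def mirror_mem)

lemma rigid_motion_odd: "odd j \<Longrightarrow> rigid_motion a 0 c \<in> sym_motion_space j"
  by (auto simp: sym_motion_iff rigid_motion_def mirror_mem placement_mirror)

text \<open>As many coordinates at one orbit as the symmetric rigid motions have dimensions: one for
  even \<open>j\<close>, two for odd \<open>j\<close>.\<close>

definition pins :: "nat \<Rightarrow> 'a set \<Rightarrow> ('a set \<times> 2) set" where
  "pins j x = (if even j then {(x, 2)} else {(x, 1), (x, 2)})"

lemma card_pins: "card (pins j x) = (if even j then 1 else 2)"
  by (simp add: pins_def)

lemma card_edges_plus_pins_le:
  assumes iso: "symmetrically_isostatic j" and free: "even j \<or> edges_free"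
    and H: "is_subgraph VH EH G" and x: "x \<in> VH" "even j \<or> p (rep x) $ 1 \<noteq> 0"
  shows "card EH + card (pins j x) \<le> card (coords j VH)"
proof (rule card_edges_plus_dofs_le[OF iso free H])
  have xG: "x \<in> verts G" using H x(1) by (auto simp: is_subgraph_def)
  note v = rep_V[OF xG]
  have "mirror (rep x) \<noteq> rep x" if "odd j" using x(2) that mirror_fixed_iff[OF v] by simp
  then show "pins j x \<subseteq> coords j VH"
    using x(1) fixed_vert_iff[OF xG rep_mem[OF xG]]
    by (auto simp: pins_def coords_def free_coord_def)
  fix t :: "'a set \<times> 2 \<Rightarrow> complex"
  show "\<exists>a b c. rigid_motion a b c \<in> sym_motion_space j \<and>
      (\<forall>(y, i)\<in>pins j x. rigid_motion a b c (rep y) $ i = t (y, i))"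
  proof (cases "even j")
    case True
    then show ?thesis
      using rigid_motion_even[OF True, of "t (x, 2)"] v
      by (intro exI[of _ 0] exI[of _ "t (x, 2)"]) (auto simp: pins_def rigid_motion_nth)
  next
    case False
    \<comment> \<open>Off the mirror line the rotation alone attains the vertical value; the
      horizontal translation then makes up for the horizontal part of the rotation.\<close>
    define c where "c = t (x, 2) / complex_of_real (p (rep x) $ 1)"
    have "rigid_motion (t (x, 1) + c * p (rep x) $ 2) 0 c \<in> sym_motion_space j"
      by (rule rigid_motion_odd[OF False])
    then show ?thesis
      using False v x(2)
      by (intro exI[of _ "t (x, 1) + c * p (rep x) $ 2"] exI[of _ 0] exI[of _ c])
        (auto simp: pins_def rigid_motion_nth c_def)
  qed
qed

text \<open>Edges and pins together determine a symmetric motion: a kernel element lifts to an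
  infinitesimal motion, which is rigid by hypothesis, and the pins exclude nonzero symmetric rigid
  motions.\<close>

lemma card_coords_le:
  assumes iso: "symmetrically_isostatic j"
    and x: "x \<in> verts G" "p (rep x) $ 1 \<noteq> 0"
  shows "card (coords j (verts G)) \<le> card (edges G) + card (pins j x)"
proof -
  define \<epsilon> where "\<epsilon> e = (SOME d. d \<in> e)" for e :: "'a set set"
  have \<epsilon>: "\<epsilon> e \<in> e" if "e \<in> edges G" for e
    unfolding \<epsilon>_def using edge_nonempty[OF that] by (rule someI_ex)
  have fin: "finite (edges G)" "finite (pins j x)"
    by (simp_all add: finite_edgesG pins_def)
  have "card (coords j (verts G)) \<le> card (edges G <+> pins j x)"
  proof (rule card_le_of_linear_inj[OF linear_constraint_map[of j \<epsilon>]])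
    show "finite (coords j (verts G))" by (rule finite_coords) simp
    show "finite (edges G <+> pins j x)" using fin by simp
    fix z assume z: "\<forall>k. k \<notin> coords j (verts G) \<longrightarrow> z k = 0"
      and ker: "\<forall>k\<in>edges G <+> pins j x. constraint_map j \<epsilon> z k = 0"
    define m where "m = lift_motion j z"
    have m: "m \<in> sym_motion_space j"
      unfolding m_def by (rule lift_motion_sym[OF _ z]) simp
    have pin: "z k = 0" if "k \<in> pins j x" for k
      using bspec[OF ker, of "Inr k"] that by (simp add: constraint_map_def InrI)
    have "rigidity_map m d = 0" if d: "d \<in> E" for d
    proof -
      let ?e = "{d, mirror ` d}"
      have "?e \<in> edges G" by (rule edge_of[OF d])
      then have "rigidity_map m (\<epsilon> ?e) = 0" and "\<epsilon> ?e \<in> ?e"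
        using bspec[OF ker, of "Inl ?e"] \<epsilon>[of ?e]
        by (simp add: constraint_map_def InlI m_def, blast)
      then show ?thesis using rigidity_map_mirror[OF m d] by auto
    qed
    then have "trivial_motion m"
      using iso m by (auto simp: symmetrically_isostatic_def infinitesimal_motion_def)
    then obtain a b c where abc: "\<And>v. v \<in> V \<Longrightarrow> m v = rigid_motion a b c v"
      using trivial_motion_rigid by blast
    define v where "v = rep x"
    have v: "v \<in> V" "p v $ 1 \<noteq> 0" using rep_V[OF x(1)] x(2) by (auto simp: v_def)
    have zx: "z (x, 1) = a - c * p v $ 2" "z (x, 2) = b + c * p v $ 1"
      using lift_motion_rep[OF x(1), of j z] abc[OF v(1)] rigid_motion_nth[OF v(1), of a b c]
      by (metis m_def v_def)+
    \<comment> \<open>Symmetry at one vertex off the mirror line eliminates \<open>a\<close> and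
      \<open>c\<close> for even \<open>j\<close> and \<open>b\<close> for odd \<open>j\<close>; the
      pins eliminate the rest.\<close>
    have sym: "a - c * p v $ 2 = - ((-1) ^ j * (a - c * p v $ 2))"
      "b - c * p v $ 1 = (-1) ^ j * (b + c * p v $ 1)"
      using m v(1) abc[OF v(1)] abc[OF mirror_mem[OF v(1)]]
      by (auto simp: sym_motion_iff rigid_motion_nth mirror_mem placement_mirror
          dest!: bspec[of _ _ v])
    have "a = 0 \<and> b = 0 \<and> c = 0"
    proof (cases "even j")
      case True
      then have "z (x, 2) = 0" using pin by (simp add: pins_def)
      then show ?thesis using sym True zx v(2) by auto
    next
      case False
      then have "z (x, 1) = 0" "z (x, 2) = 0" using pin by (simp_all add: pins_def)
      then show ?thesis using sym False zx v(2) by auto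
    qed
    then have m0: "m v = 0" if "v \<in> V" for v
      using abc[OF that] that by (simp add: vec_2_eq_iff rigid_motion_nth)
    show "z = 0"
    proof
      fix k :: "'a set \<times> 2"
      obtain y i where k: "k = (y, i)" by fastforce
      show "z k = 0 k"
      proof (cases "y \<in> verts G")
        case True
        then show ?thesis
          using lift_motion_rep[OF True, of j z i] m0[OF rep_V[OF True]] by (simp add: k m_def)
      next
        case False
        then show ?thesis using z by (simp add: k coords_def)
      qed
    qed
  qed
  then show ?thesis using fin by (simp add: card_Plus)
qed

section \<open>Balanced subgraphs\<close>

lemma edge_action_closed:
  assumes e: "e \<in> edges G" "d \<in> e" and g: "g \<in> carrier \<Gamma>"
  shows "\<phi> g ` d \<in> e"
proof -
  have "edge_action g d = d \<or> edge_action g d = mirror ` d"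
    using g edge_action_one[OF edge_mem(1)[OF e]] edge_action_gen[of d] unfolding gen(1) by blast
  then show ?thesis using edge_mem(2)[OF e] unfolding edge_action_def by blast
qed

text \<open>Moving each representative by a potential makes all gains between free orbits trivial.
  This is the switching operation on gain graphs.\<close>

lemma balanced_representatives:
  assumes H: "is_subgraph VH EH G" and bal: "balanced \<Gamma> G \<psi> EH"
  obtains r where "\<And>x. x \<in> verts G \<Longrightarrow> r x \<in> x" "\<And>e. e \<in> EH \<Longrightarrow> {r (src G e), r (tgt G e)} \<in> e"
proof -
  have EH: "EH \<subseteq> edges G" using H by (simp add: is_subgraph_def)
  define F where "F = {e \<in> EH. src G e \<notin> fixed_verts G \<and> tgt G e \<notin> fixed_verts G}"
  have "finite F"
    by (rule finite_subset[OF _ finite_edgesG]) (use EH in \<open>auto simp: F_def\<close>)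
  moreover have \<psi>: "\<psi> e \<in> carrier \<Gamma>" if "e \<in> F" for e
    using that EH gain_closed by (auto simp: F_def)
  ultimately obtain \<theta> where \<theta>: "\<And>x. \<theta> x \<in> carrier \<Gamma>"
    and pot: "\<And>e. e \<in> F \<Longrightarrow> \<theta> (src G e) \<otimes> \<psi> e = \<theta> (tgt G e)"
    using group.balanced_potential[OF group_\<Gamma>, of F \<psi> G] bal
    unfolding balanced_def F_def[symmetric] by blast
  define r where "r x = \<phi> (\<theta> x) (rep x)" for x
  have r: "r x \<in> x" if x: "x \<in> verts G" for x
  proof -
    have "r x = rep x \<or> r x = mirror (rep x)"
      using \<theta>[of x] rep_V[OF x] by (auto simp: r_def gen phi_one mirror_def)
    then show ?thesis using vert_rep[OF x] by auto
  qed
  have "{r (src G e), r (tgt G e)} \<in> e" if e: "e \<in> EH" for e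
  proof -
    have eG: "e \<in> edges G" using e EH by auto
    note ev = ends_verts[OF eG]
    obtain d where "d \<in> e" using edge_nonempty[OF eG] by blast
    obtain u v where d: "{u, v} \<in> e" "u \<in> src G e" "v \<in> tgt G e"
      using edge_ends_mem[OF eG \<open>d \<in> e\<close>] \<open>d \<in> e\<close> by metis
    have dm: "{mirror u, mirror v} \<in> e" using edge_mem(2)[OF eG d(1)] by auto
    have u: "r (src G e) = u \<or> r (src G e) = mirror u"
      using r[OF ev(1)] vert_mem(2)[OF ev(1) d(2)] by auto
    have v: "r (tgt G e) = v \<or> r (tgt G e) = mirror v"
      using r[OF ev(2)] vert_mem(2)[OF ev(2) d(3)] by auto
    show ?thesis
    proof (cases "e \<in> F")
      case True
      then have "{rep (src G e), \<phi> (\<psi> e) (rep (tgt G e))} \<in> e"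
        using gain_free[OF eG] by (auto simp: F_def)
      \<comment> \<open>The group element at the source is applied to the whole edge; the potential
        equation then identifies the image of its other end with \<open>r (tgt G e)\<close>.\<close>
      then have "\<phi> (\<theta> (src G e)) ` {rep (src G e), \<phi> (\<psi> e) (rep (tgt G e))} \<in> e"
        by (rule edge_action_closed[OF eG _ \<theta>])
      then show ?thesis
        using composition_rule[OF rep_V[OF ev(2)] \<theta> \<psi>[OF True], of "src G e"] pot[OF True]
        by (simp add: r_def)
    next
      case False
      \<comment> \<open>If one end is fixed, the two edges of the orbit join it to both vertices
        over the other end, so every choice of representatives works.\<close>
      then consider "src G e \<in> fixed_verts G" | "tgt G e \<in> fixed_verts G"
        using e by (auto simp: F_def)
      then show ?thesis
      proof cases
        case 1
        then have "mirror u = u" using fixed_vert_iff[OF ev(1) d(2)] by simp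
        then show ?thesis using u v d(1) dm by auto
      next
        case 2
        then have "mirror v = v" using fixed_vert_iff[OF ev(2) d(3)] by simp
        then show ?thesis using u v d(1) dm by auto
      qed
    qed
  qed
  with r show ?thesis using that by blast
qed

text \<open>The chosen representatives turn a balanced subgraph into an ordinary plane framework,
  whose independent rows are limited by the three-dimensional space of rigid motions.\<close>

lemma card_balanced_le:
  assumes iso: "symmetrically_isostatic j" and free: "even j \<or> edges_free"
    and H: "is_subgraph VH EH G" and bal: "balanced \<Gamma> G \<psi> EH" and ne: "EH \<noteq> {}"
  shows "card EH + 3 \<le> 2 * card VH"
proof -
  have VH: "VH \<subseteq> verts G" and EH: "EH \<subseteq> edges G" using H by (auto simp: is_subgraph_def)
  have fin: "finite VH" "finite EH"
    using VH EH finite_vertsG finite_edgesG finite_subset by blast+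
  obtain r where r: "\<And>x. x \<in> verts G \<Longrightarrow> r x \<in> x"
    and re: "\<And>e. e \<in> EH \<Longrightarrow> {r (src G e), r (tgt G e)} \<in> e"
    using balanced_representatives[OF H bal] by blast
  define \<epsilon> where "\<epsilon> e = (if e \<in> EH then {r (src G e), r (tgt G e)} else SOME d. d \<in> e)" for e
  have \<epsilon>: "\<epsilon> e \<in> e" if "e \<in> edges G" for e
    using re someI_ex[OF edge_nonempty[OF that]] by (auto simp: \<epsilon>_def)
  obtain e\<^sub>0 where e\<^sub>0: "e\<^sub>0 \<in> EH" using ne by blast
  define x y where "x = src G e\<^sub>0" and "y = tgt G e\<^sub>0"
  define P Q where "P = p (r x)" and "Q = p (r y)"
  have xy: "x \<in> VH" "y \<in> VH" using H e\<^sub>0 by (auto simp: is_subgraph_def x_def y_def)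
  have "{r x, r y} \<in> E" using re[OF e\<^sub>0] edge_mem(1)[of e\<^sub>0] e\<^sub>0 EH by (auto simp: x_def y_def)
  then have "r x \<in> V" "r y \<in> V" "r x \<noteq> r y" using edge_pair by blast+
  then have PQ: "P $ 1 \<noteq> Q $ 1 \<or> P $ 2 \<noteq> Q $ 2" and "x \<noteq> y"
    using placement_ne by (auto simp: P_def Q_def)
  \<comment> \<open>A rotation about \<open>P\<close> moves \<open>Q\<close> perpendicularly to
    their difference; \<open>i\<close> is a direction in which this velocity is nonzero. Pinning
    both coordinates at \<open>x\<close> and this one at \<open>y\<close> takes up all three rigid
    degrees of freedom.\<close>
  define i :: 2 where "i = (if P $ 1 \<noteq> Q $ 1 then 2 else 1)"
  define D where "D = {(x, 1), (x, 2), (y, i)}"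
  \<comment> \<open>The rigidity map of the plane framework on the representatives, with two
    coordinates at fixed orbits as well.\<close>
  define F :: "('a set \<times> 2 \<Rightarrow> complex) \<Rightarrow> 'a set set + 'a set \<times> 2 \<Rightarrow> complex" where
    "F z = case_sum (\<lambda>e. \<Sum>k\<in>UNIV. complex_of_real (p (r (src G e)) $ k - p (r (tgt G e)) $ k) *
      (z (src G e, k) - z (tgt G e, k))) z" for z
  have "card (EH <+> D) \<le> card (VH \<times> (UNIV :: 2 set))"
  proof (rule card_le_of_linear_surj[of F])
    show "Vector_Spaces.linear edge_scale edge_scale F"
      by unfold_locales
        (auto simp: F_def fun_eq_iff sum_2 edge_scale_def algebra_simps split: sum.splits)
    show "finite (VH \<times> (UNIV :: 2 set))" "finite (EH <+> D)"
      using fin by (simp_all add: D_def)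
    fix w :: "'a set set + 'a set \<times> 2 \<Rightarrow> complex"
    obtain m where m: "\<And>e. e \<in> edges G \<Longrightarrow> rigidity_map m (\<epsilon> e) = w (Inl e)"
      using rigidity_map_surj_quotient[OF iso free \<epsilon>, of "\<lambda>e. w (Inl e)"] by blast
    define t where "t k = w (Inr k) - m (r (fst k)) $ snd k" for k
    \<comment> \<open>The speed of rotation that yields the required relative value of the pinned
      coordinate at \<open>Q\<close>; the translation below fits the values at
      \<open>P\<close>.\<close>
    define c where "c = (if P $ 1 \<noteq> Q $ 1 then (t (y, 2) - t (x, 2)) / of_real (Q $ 1 - P $ 1)
      else (t (x, 1) - t (y, 1)) / complex_of_real (Q $ 2 - P $ 2))"
    define n where "n = m + rigid_motion (t (x, 1) + c * P $ 2) (t (x, 2) - c * P $ 1) c"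
    have c1: "c * (of_real (Q $ 1) - of_real (P $ 1)) = t (y, 2) - t (x, 2)" if "P $ 1 \<noteq> Q $ 1"
      using that by (simp add: c_def)
    have c2: "c * (of_real (Q $ 2) - of_real (P $ 2)) = t (x, 1) - t (y, 1)" if "P $ 1 = Q $ 1"
      using that PQ by (simp add: c_def)
    have nD: "n (r a) $ k = w (Inr (a, k))" if "(a, k) \<in> D" for a k
    proof -
      have "rigid_motion (t (x, 1) + c * P $ 2) (t (x, 2) - c * P $ 1) c (r a) $ k = t (a, k)"
        using that \<open>r x \<in> V\<close> \<open>r y \<in> V\<close> c1 c2
        by (auto simp: D_def i_def rigid_motion_nth P_def[symmetric] Q_def[symmetric] algebra_simps
            split: if_splits)
      then show ?thesis by (simp add: n_def t_def)
    qed
    \<comment> \<open>Only values at representatives are read off, so the correction may be any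
      rigid motion, symmetric or not.\<close>
    define z where "z k = (if fst k \<in> VH then n (r (fst k)) $ snd k else 0)" for k
    have "F z k = w k" if k: "k \<in> EH <+> D" for k
    proof (cases k)
      case (Inl e)
      with k have e: "e \<in> EH" "e \<in> edges G" using EH by auto
      have "{r (src G e), r (tgt G e)} \<in> E" using edge_mem(1)[OF e(2) re[OF e(1)]] .
      then have "F z k = rigidity_map n (\<epsilon> e)"
        using H e(1) by (simp add: F_def Inl \<epsilon>_def rigidity_map_edge z_def is_subgraph_def)
      also have "\<dots> = w k" using m[OF e(2)] by (simp add: n_def rigidity_map_add_rigid_motion Inl)
      finally show ?thesis .
    next
      case (Inr ak)
      obtain a l where al: "ak = (a, l)" by fastforce
      with k Inr have "(a, l) \<in> D" by auto
      moreover from this have "a \<in> VH" using xy by (auto simp: D_def)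
      ultimately show ?thesis by (simp add: F_def Inr al z_def nD)
    qed
    then show "\<exists>z. (\<forall>k. k \<notin> VH \<times> UNIV \<longrightarrow> z k = 0) \<and> (\<forall>k\<in>EH <+> D. F z k = w k)"
      by (intro exI[of _ z]) (auto simp: z_def)
  qed
  moreover have "card D = 3" using \<open>x \<noteq> y\<close> by (simp add: D_def)
  moreover have "finite D" by (simp add: D_def)
  ultimately show ?thesis using fin by (simp add: card_Plus card_cartesian_product)
qed

section \<open>Sparsity and tightness\<close>

lemma subgraph_free_vert:
  assumes free: "edges_free" and H: "is_subgraph VH EH G" and ne: "EH \<noteq> {}"
  shows "\<exists>x\<in>VH. p (rep x) $ 1 \<noteq> 0"
proof -
  obtain e where e: "e \<in> EH" "e \<in> edges G" using H ne by (auto simp: is_subgraph_def)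
  then have VH: "src G e \<in> VH" "tgt G e \<in> VH" using H by (auto simp: is_subgraph_def)
  obtain d where d: "d \<in> e" using edge_nonempty[OF e(2)] by blast
  then obtain u v where uv: "d = {u, v}" "u \<in> src G e" "v \<in> tgt G e"
    using edge_ends_mem[OF e(2)] by metis
  have "mirror ` d \<noteq> d" using free edge_mem(1)[OF e(2) d] by (simp add: edges_free_iff)
  \<comment> \<open>An edge with both ends on the mirror line would be its own mirror image.\<close>
  then have "mirror u \<noteq> u \<or> mirror v \<noteq> v" using uv by auto
  moreover have "p (rep x) $ 1 \<noteq> 0" if "x \<in> verts G" "v \<in> x" "mirror v \<noteq> v" for x v
    using that fixed_vert_iff[of x] rep_mem[of x] mirror_fixed_iff[OF rep_V[of x]] by blast
  ultimately show ?thesis using VH uv ends_verts[OF e(2)] by metis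
qed

lemma gain_tight_of_isostatic:
  assumes iso: "symmetrically_isostatic j" and free: "even j \<or> edges_free"
  shows "gain_tight \<Gamma> G \<psi> 2 1 3 (if even j then 1 else 2)"
proof -
  have sparse: "int (card EH) \<le> 2 * int (card VH) - 3"
    if "is_subgraph VH EH G" "EH \<noteq> {}" "balanced \<Gamma> G \<psi> EH" for VH EH
    using card_balanced_le[OF iso free that(1) that(3) that(2)] by linarith
  have count: "int (card EH) \<le> 2 * int (card (VH - fixed_verts G)) +
      1 * int (card (VH \<inter> fixed_verts G)) - (if even j then 1 else 2)"
    if H: "is_subgraph VH EH G" and x: "x \<in> VH" "even j \<or> p (rep x) $ 1 \<noteq> 0" for VH EH x
  proof -
    have VH: "VH \<subseteq> verts G" using H by (simp add: is_subgraph_def)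
    show ?thesis
      using card_edges_plus_pins_le[OF iso free H x] card_pins[of j x] card_coords[OF VH, of j]
      by (simp split: if_splits)
  qed
  \<comment> \<open>Any vertex serves for even \<open>j\<close>; for odd \<open>j\<close> the two
    pins need a vertex off the mirror line.\<close>
  have pinned: "\<exists>x\<in>VH. even j \<or> p (rep x) $ 1 \<noteq> 0"
    if "is_subgraph VH EH G" "EH \<noteq> {}" for VH EH
  proof (cases "even j")
    case True
    then show ?thesis using that by (auto simp: is_subgraph_def)
  next
    case False
    then show ?thesis using free subgraph_free_vert[OF _ that] by blast
  qed
  obtain v where v: "v \<in> V" "p v $ 1 \<noteq> 0" using exists_off_axis by blast
  define x where "x = {v, mirror v}"
  have x: "x \<in> verts G" unfolding x_def by (rule vert_of[OF v(1)])
  have px: "p (rep x) $ 1 \<noteq> 0"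
    using rep_mem[OF x] v placement_mirror[OF v(1)] by (auto simp: x_def)
  \<comment> \<open>\<open>count\<close> takes an orbit to pin instead of an edge, so it bounds the
    whole graph even if that has no edges.\<close>
  have "is_subgraph (verts G) (edges G) G" by (auto simp: is_subgraph_def ends_verts)
  then have le: "int (card (edges G)) \<le> 2 * int (card (verts G - fixed_verts G)) +
      1 * int (card (verts G \<inter> fixed_verts G)) - (if even j then 1 else 2)"
    using count x px by blast
  have "card (coords j (verts G)) \<le> card (edges G) + card (pins j x)"
    by (rule card_coords_le[OF iso x px])
  then have "2 * int (card (verts G - fixed_verts G)) + 1 * int (card (verts G \<inter> fixed_verts G))
      - (if even j then 1 else 2) \<le> int (card (edges G))"
    using card_pins[of j x] card_coords[of "verts G" j] by (simp split: if_splits)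
  with le sparse count pinned show ?thesis
    unfolding gain_tight_def gain_sparse_def by (blast intro: antisym)
qed

end

theorem proposition5p3:
  fixes \<Gamma> :: "('g, 'z) monoid_scheme"
    and V :: "'a set" and E :: "'a set set" and \<phi> :: "'g \<Rightarrow> 'a \<Rightarrow> 'a"
    and \<tau> :: "'g \<Rightarrow> real^2^2" and p :: "'a \<Rightarrow> real^2"
    and rep :: "'a set \<Rightarrow> 'a" and G :: "('a set, 'a set set) multigraph"
    and \<psi> :: "'a set set \<Rightarrow> 'g" and q :: "'a set \<Rightarrow> real^2"
  assumes "cs_gain_framework \<Gamma> V \<phi> E \<tau> p rep G \<psi> q"
  shows "(cs_framework.symmetrically_isostatic \<Gamma> V \<phi> E \<tau> p 0 \<longrightarrow> gain_tight \<Gamma> G \<psi> 2 1 3 1) \<and>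
    (cs_framework.symmetrically_isostatic \<Gamma> V \<phi> E \<tau> p 1 \<and> cs_framework.edges_free \<Gamma> \<phi> E
       \<longrightarrow> gain_tight \<Gamma> G \<psi> 2 1 3 2)"
proof -
  interpret cs_gain_framework \<Gamma> V \<phi> E \<tau> p rep G \<psi> q by fact
  show ?thesis
    using gain_tight_of_isostatic[of 0] gain_tight_of_isostatic[of 1] by simp
qed

end
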